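(* Let $\alpha\in\mathbb{R}$ be irrational with continued fraction expansion $\alpha=[a_0;a_1,a_2,\dots]$, let $n\in\mathbb{N}$, and let $\frac{p_n}{q_n}=[a_0;a_1,\dots,a_n]$ be the $n$-th convergent of $\alpha$. Let $$\mathcal{L}_n(\alpha)=\left\{\left(\frac{k}{q_n},\left\{\frac{k p_n}{q_n}\right\}\right): k=0,1,\dots,q_n-1\right\}.$$ Then $$(L_{2,q_n}(\mathcal{L}_n(\alpha)))^2 = \frac{1}{16 q_n^2}\sum_{r=1}^{q_n-1} \frac{1+2 \cos^2\left(\frac{\pi r p_n}{q_n}\right)}{\sin^2\left(\frac{\pi r}{q_n}\right)\sin^2\left(\frac{\pi rp_n}{q_n}\right)}+\left(\mathcal{D}(p_n,q_n)+\frac{3}{4}\right)^2+\frac{1}{18}-\frac{1}{144 q_n^2},$$ $$(L_{2,q_n}^{\mathrm{extr}}(\mathcal{L}_n(\alpha)))^2=\frac{1}{16q_n^2}\sum_{r=1}^{q_n-1}\frac{1}{\sin^2\left(\frac{\pi r}{q_n}\right)\sin^2\left(\frac{\pi rp_n}{q_n}\right)}+\frac{1}{72}-\frac{1}{144q_n^2},$$ and $$(L_{2,q_n}^{\mathrm{per}}(\mathcal{L}_n(\alpha)))^2 = \frac{1}{4 q_n^2}\sum_{r=1}^{q_n-1}\frac{1}{\sin^2\left(\frac{\pi r}{q_n}\right)\sin^2\left(\frac{\pi rp_n}{q_n}\right)}+\frac19+\frac{1}{36q_n^2},$$ where $\mathcal{D}(p,q)$ is the inhomogeneous Dedekind sum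 $$\mathcal{D}(p,q)=\sum_{k=1}^{q-1} \rho\left(\frac{k}{q}\right) \rho\left(\frac{kp}{q}\right),\qquad \rho(x)=\frac{1}{2}-\{x\}.$$
   Context: $\{x\}=x-\lfloor x\rfloor$ denotes the fractional part of a real number $x$ (when applied to numbers). The convergent $p_n/q_n$ is written in lowest terms with $q_n\ge1$. Let $\mathcal{P}=\{\boldsymbol{x}_0,\dots,\boldsymbol{x}_{N-1}\}$ be an $N$-element point set in $[0,1)^2$. For measurable $B\subseteq[0,1]^2$ let $A(B,\mathcal{P})=|\{n\in\{0,\dots,N-1\}: \boldsymbol{x}_n\in B\}|$, and let $\lambda$ be Lebesgue measure. For $\boldsymbol{x}=(x_1,x_2)$ and $\boldsymbol{y}=(y_1,y_2)$ in $[0,1]^2$, $\boldsymbol{x}\le\boldsymbol{y}$ means $x_1\le y_1$ and $x_2\le y_2$, and then $[\boldsymbol{x},\boldsymbol{y})=[x_1,y_1)\times[x_2,y_2)$. For $x,y\in[0,1]$ set $I(x,y)=[x,y)$ if $x\le y$ and $I(x,y)=[0,y)\cup[x,1)$ if $x>y$; set $B(\boldsymbol{x},\boldsymbol{y})=I(x_1,y_1)\times I(x_2,y_2)$. Standard $L_2$ discrepancy: $$L_{2,N}(\mathcal{P})=\left(\int_{[0,1]^2}|A([\boldsymbol{0},\boldsymbol{t}),\mathcal{P})-N\lambda([\boldsymbol{0},\boldsymbol{t}))|^2\,\mathrm{d}\boldsymbol{t}\right)^{1/2}.$$ Extreme $L_2$ discrepancy: $$L_{2,N}^{\mathrm{extr}}(\mathcal{P})=\left(\int_{[0,1]^2}\int_{[0,1]^2,\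 \boldsymbol{x}\le\boldsymbol{y}}|A([\boldsymbol{x},\boldsymbol{y}),\mathcal{P})-N\lambda([\boldsymbol{x},\boldsymbol{y}))|^2\,\mathrm{d}\boldsymbol{x}\,\mathrm{d}\boldsymbol{y}\right)^{1/2}.$$ Periodic $L_2$ discrepancy: $$L_{2,N}^{\mathrm{per}}(\mathcal{P})=\left(\int_{[0,1]^2}\int_{[0,1]^2}|A(B(\boldsymbol{x},\boldsymbol{y}),\mathcal{P})-N\lambda(B(\boldsymbol{x},\boldsymbol{y}))|^2\,\mathrm{d}\boldsymbol{x}\,\mathrm{d}\boldsymbol{y}\right)^{1/2}.$$ *)

theory Defs
  imports "HOL-Analysis.Analysis"
begin

primrec fin_cfrac :: "(nat \<Rightarrow> int) \<Rightarrow> nat \<Rightarrow> real" where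
  "fin_cfrac a 0 = real_of_int (a 0)"
| "fin_cfrac a (Suc n) = real_of_int (a 0) + 1 / fin_cfrac (\<lambda>i. a (Suc i)) n"

text \<open>
  \<open>\<alpha> = [a\<^sub>0; a\<^sub>1, a\<^sub>2, \<dots>]\<close>, an infinite (simple) continued fraction. Positivity of the
  \<open>a\<^sub>i\<close> for \<open>i \<ge> 1\<close> also ensures that no division by zero occurs in the finite fractions.
\<close>
definition has_cfrac_expansion :: "real \<Rightarrow> (nat \<Rightarrow> int) \<Rightarrow> bool" where
  "has_cfrac_expansion \<alpha> a \<longleftrightarrow> (\<forall>i\<ge>1. a i \<ge> 1) \<and> (\<lambda>n. fin_cfrac a n) \<longlonglongrightarrow> \<alpha>"

definition unit_square :: "(real \<times> real) set" where
  "unit_square = {0..1} \<times> {0..1}"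

definition box_leq :: "real \<times> real \<Rightarrow> real \<times> real \<Rightarrow> bool" where
  "box_leq x y \<longleftrightarrow> fst x \<le> fst y \<and> snd x \<le> snd y"

definition ho_box :: "real \<times> real \<Rightarrow> real \<times> real \<Rightarrow> (real \<times> real) set" where
  "ho_box x y = {fst x..<fst y} \<times> {snd x..<snd y}"

definition per_interval :: "real \<Rightarrow> real \<Rightarrow> real set" where
  "per_interval x y = (if x \<le> y then {x..<y} else {0..<y} \<union> {x..<1})"

definition per_box :: "real \<times> real \<Rightarrow> real \<times> real \<Rightarrow> (real \<times> real) set" where
  "per_box x y = per_interval (fst x) (fst y) \<times> per_interval (snd x) (snd y)"

definition count_in :: "(real \<times> real) set \<Rightarrow> (real \<times> real) set \<Rightarrow> nat" where
  "count_in B P = card {x \<in> P. x \<in> B}"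

text \<open>
  \<open>A(B, P) - N \<lambda>(B)\<close>, where \<open>N\<close> is the number of elements of the finite point set \<open>P\<close>.
\<close>
definition local_disc :: "(real \<times> real) set \<Rightarrow> (real \<times> real) set \<Rightarrow> real" where
  "local_disc B P = real (count_in B P) - real (card P) * measure lborel B"

definition L2_disc :: "(real \<times> real) set \<Rightarrow> real" where
  "L2_disc P = sqrt (LINT t:unit_square|lborel. \<bar>local_disc (ho_box (0, 0) t) P\<bar>\<^sup>2)"

definition L2_disc_extr :: "(real \<times> real) set \<Rightarrow> real" where
  "L2_disc_extr P = sqrt (LINT y:unit_square|lborel.
     (LINT x:{x \<in> unit_square. box_leq x y}|lborel. \<bar>local_disc (ho_box x y) P\<bar>\<^sup>2))"

definition L2_disc_per :: "(real \<times> real) set \<Rightarrow> real" where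
  "L2_disc_per P = sqrt (LINT y:unit_square|lborel.
     (LINT x:unit_square|lborel. \<bar>local_disc (per_box x y) P\<bar>\<^sup>2))"

definition rational_lattice :: "int \<Rightarrow> nat \<Rightarrow> (real \<times> real) set" where
  "rational_lattice p q =
     (\<lambda>k. (real k / real q, frac (real k * real_of_int p / real q))) ` {0..<q}"

definition rho :: "real \<Rightarrow> real" where
  "rho x = 1 / 2 - frac x"

text \<open>
  The inhomogeneous Dedekind sum; unlike the sawtooth function of the classical Dedekind sum,
  \<open>rho\<close> does not vanish at the integers.
\<close>
definition inhom_dedekind_sum :: "int \<Rightarrow> nat \<Rightarrow> real" where
  "inhom_dedekind_sum p q =
     (\<Sum>k=1..<q. rho (real k / real q) * rho (real k * real_of_int p / real q))"

end

theory Submission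
  imports Defs
begin

text \<open>
  Expanding the square of the local discrepancy and integrating expresses each of the three
  discrepancies as \<open>\<Sum>i j. k(x\<^sub>i, x\<^sub>j) k(y\<^sub>i, y\<^sub>j) - 2q \<Sum>i. k\<^sub>1(x\<^sub>i) k\<^sub>1(y\<^sub>i) + q\<^sup>2 k\<^sub>0\<^sup>2\<close> with explicit
  one-dimensional kernels, and each kernel is a polynomial in \<open>rho s\<close>, \<open>rho t\<close> and \<open>rho (s - t)\<^sup>2\<close>.
  For a lattice, every resulting double sum depends on differences modulo \<open>q\<close> only, or reduces to
  such a sum through the autocorrelation of \<open>rho\<close>, which is again affine in \<open>rho\<^sup>2\<close>. All that
  remains is \<open>\<Sum>k. rho (k / q)\<^sup>2 rho (k p / q)\<^sup>2\<close>. The finite Fourier coefficients of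
  \<open>rho (k / q)\<^sup>2\<close> are multiples of \<open>1 / sin\<^sup>2 (pi r / q)\<close>, since the second difference of the
  cosine series with these coefficients is constant away from \<open>0\<close>, and orthogonality of the
  cosines turns the sum into the one in the theorem. The only asymmetric contribution, the square of
  \<open>inhom_dedekind_sum p q + 3 / 4\<close>, comes from the product \<open>rho s * rho t\<close> in the kernel
  \<open>1 - max s t\<close>.
\<close>

section \<open>Sums of the sawtooth function over residues\<close>

text \<open>Multiplication by a unit followed by a translation permutes the residues modulo
  \<open>q\<close>. The dilations by \<open>p\<close>, reflections and shifts of lattice sums below
  are instances.\<close>

lemma sum_periodic_affine:
  fixes g :: "int \<Rightarrow> real"
  assumes per: "\<And>k. g (k mod int q) = g k" and "q \<ge> 1" and cop: "coprime p (int q)"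
  shows "(\<Sum>k<q. g (p * int k + c)) = (\<Sum>k<q. g (int k))"
proof -
  let ?h = "\<lambda>k::nat. nat ((p * int k + c) mod int q)"
  have inj: "inj_on ?h {..<q}"
  proof (rule inj_onI)
    fix k l assume k: "k \<in> {..<q}" and l: "l \<in> {..<q}" and e: "?h k = ?h l"
    have "(p * int k + c) mod int q = (p * int l + c) mod int q"
      using e \<open>q \<ge> 1\<close> by (metis Euclidean_Rings.pos_mod_sign eq_nat_nat_iff of_nat_0_less_iff order.strict_trans1 zero_less_one less_le_trans)
    then have "int q dvd (p * int k + c) - (p * int l + c)"
      by (simp add: mod_eq_dvd_iff)
    then have "int q dvd p * (int k - int l)" by (simp add: algebra_simps)
    then have "int q dvd int k - int l"
      using cop by (simp add: coprime_dvd_mult_right_iff coprime_commute)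
    then have "int k mod int q = int l mod int q" by (simp add: mod_eq_dvd_iff)
    then show "k = l" using k l by simp
  qed
  have sub: "?h ` {..<q} \<subseteq> {..<q}"
    using \<open>q \<ge> 1\<close> by (auto simp: nat_less_iff)
  have bij: "bij_betw ?h {..<q} {..<q}"
    using inj sub by (simp add: bij_betw_def endo_inj_surj)
  have "(\<Sum>k<q. g (int k)) = (\<Sum>k<q. g (int (?h k)))"
    using sum.reindex_bij_betw[OF bij, of "\<lambda>k. g (int k)"] by simp
  also have "\<dots> = (\<Sum>k<q. g (p * int k + c))"
    using \<open>q \<ge> 1\<close> by (intro sum.cong) (simp_all add: per)
  finally show ?thesis by simp
qed

section \<open>Periodicity of the sawtooth and its power sums\<close>

lemma rho_add_int [simp]: "rho (x + of_int k) = rho x" "rho (of_int k + x) = rho x"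
  by (simp_all add: rho_def frac_def)

lemma rho_frac [simp]: "rho (frac x) = rho x"
  by (simp add: rho_def)

lemma rho_mod:
  assumes "q \<ge> 1"
  shows "rho (of_int (k mod int q) * of_int p / real q) = rho (of_int k * of_int p / real q)"
proof -
  have "real_of_int k = of_int (k mod int q) + real q * of_int (k div int q)"
    by (metis mod_mult_div_eq of_int_add of_int_mult of_int_of_nat_eq)
  then have "of_int k * of_int p / real q
      = of_int (k mod int q) * of_int p / real q + of_int ((k div int q) * p)"
    using assms by (simp add: field_simps)
  then show ?thesis by (metis rho_add_int(1))
qed

lemma rho_mod1:
  assumes "q \<ge> 1"
  shows "rho (of_int (k mod int q) / real q) = rho (of_int k / real q)"
  using rho_mod[OF assms, of k 1] by simp

lemma sum_rho_mult:
  fixes F :: "real \<Rightarrow> real"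
  assumes "q \<ge> 1" "coprime p (int q)"
  shows "(\<Sum>k<q. F (rho (real k * of_int p / real q))) = (\<Sum>k<q. F (rho (real k / real q)))"
  using sum_periodic_affine[of "\<lambda>k. F (rho (of_int k / real q))" q p 0] assms
  by (simp add: rho_mod1 mult.commute)

lemma rho_lattice: "k < q \<Longrightarrow> rho (real k / real q) = 1 / 2 - real k / real q"
  by (simp add: rho_def frac_eq)

lemma sum_nat_real: "(\<Sum>k<q. real k) = real q * (real q - 1) / 2"
  by (induction q) (auto simp: field_simps)

lemma sum_nat_sq_real: "(\<Sum>k<q. (real k)\<^sup>2) = real q * (real q - 1) * (2 * real q - 1) / 6"
  by (induction q) (auto simp: field_simps power2_eq_square)

lemma sum_rho: "q \<ge> 1 \<Longrightarrow> (\<Sum>k<q. rho (real k / real q)) = 1 / 2"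
  by (simp add: rho_lattice sum_subtractf sum_nat_real flip: sum_divide_distrib)
    (simp add: field_simps)

lemma sum_rho_sq:
  assumes "q \<ge> 1"
  shows "(\<Sum>k<q. (rho (real k / real q))\<^sup>2) = real q / 12 + 1 / (6 * real q)"
proof -
  have "(\<Sum>k<q. (rho (real k / real q))\<^sup>2)
      = (\<Sum>k<q. 1 / 4 - real k / real q + (real k)\<^sup>2 / (real q)\<^sup>2)"
    by (intro sum.cong) (simp_all add: rho_lattice power2_eq_square field_simps)
  also have "\<dots> = real q / 4 - (\<Sum>k<q. real k) / real q + (\<Sum>k<q. (real k)\<^sup>2) / (real q)\<^sup>2"
    by (simp add: sum.distrib sum_subtractf sum_divide_distrib)
  also have "\<dots> = real q / 12 + 1 / (6 * real q)"
    unfolding sum_nat_real sum_nat_sq_real using assms by (simp add: field_simps power2_eq_square)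
  finally show ?thesis .
qed

lemma rho_minus: "x \<notin> \<int> \<Longrightarrow> rho (- x) = - rho x"
  by (simp add: rho_def frac_neg)

text \<open>Off the integers \<open>rho\<close> is odd, and coprimality keeps both arguments off the
  integers for 0 < k < q. The reflection k -> -k thus cancels everything except the term k = 0,
  where \<open>rho 0 = 1 / 2\<close>.\<close>

lemma sum_rho_odd:
  assumes "q \<ge> 1" "coprime p (int q)" "coprime p' (int q)"
  shows "(\<Sum>k<q. rho (real k * of_int p / real q) * (rho (real k * of_int p' / real q))\<^sup>2) = 1 / 8"
proof -
  let ?f = "\<lambda>k::int. rho (of_int k * of_int p / real q) * (rho (of_int k * of_int p' / real q))\<^sup>2"
  have ni: "real k * of_int r / real q \<notin> \<int>" if "k \<in> {..<q} - {0}" "coprime r (int q)" for k r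
  proof
    assume "real k * of_int r / real q \<in> \<int>"
    then obtain z where "real k * of_int r / real q = of_int z" by (elim Ints_cases)
    then have "real k * of_int r = of_int z * real q" using assms(1) by (simp add: field_simps)
    then have "real_of_int (int k * r) = of_int (z * int q)" by simp
    then have "int k * r = z * int q" by (simp only: of_int_eq_iff)
    then have "int q dvd int k * r" by simp
    then have "int q dvd int k"
      using that(2) by (simp add: coprime_dvd_mult_left_iff coprime_commute)
    then show False using that(1) by (auto dest: zdvd_imp_le)
  qed
  have neg: "?f (- int k) = - ?f (int k)" if "k \<in> {..<q} - {0}" for k
    using rho_minus[OF ni[OF that assms(2)]] rho_minus[OF ni[OF that assms(3)]] by simp
  have "(\<Sum>k<q. ?f (int k)) = (\<Sum>k<q. ?f (- 1 * int k + 0))"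
    by (rule sum_periodic_affine[OF _ assms(1), symmetric]) (simp_all add: rho_mod[OF assms(1)])
  then have "(\<Sum>k\<in>{..<q} - {0}. ?f (int k)) = (\<Sum>k\<in>{..<q} - {0}. ?f (- int k))"
    using assms(1) by (simp add: sum_diff1)
  also have "\<dots> = (\<Sum>k\<in>{..<q} - {0}. - ?f (int k))"
    by (intro sum.cong refl neg) 
  finally have "(\<Sum>k\<in>{..<q} - {0}. ?f (int k)) = 0" by (simp add: sum_negf)
  then have "(\<Sum>k<q. ?f (int k)) = ?f 0"
    using assms(1) by (simp add: sum_diff1)
  then show ?thesis by (simp add: rho_def power2_eq_square)
qed

text \<open>The difference equals either \<open>- frac t\<close> or \<open>1 - frac t\<close>; the
  identity is the quadratic equation with these two roots.\<close>

lemma rho_diff_sq: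
  "(rho x - rho (x - t))\<^sup>2 = (rho x - rho (x - t)) * (1 - 2 * frac t) + frac t * (1 - frac t)"
proof -
  have "frac x = (if frac (x - t) + frac t < 1 then frac (x - t) + frac t else frac (x - t) + frac t - 1)"
    using frac_add[of "x - t" t] by simp
  then show ?thesis
    by (auto simp: rho_def algebra_simps power2_eq_square split: if_splits)
qed

text \<open>Passing to the difference \<open>rho x - rho (x - t)\<close>, which takes only two values and has
  mean zero, avoids counting how often each value occurs.\<close>

lemma rho_autocorrelation:
  assumes q: "q \<ge> 1" and cop: "coprime p (int q)"
  shows "(\<Sum>n<q. rho (real n * of_int p / real q) * rho ((real n - of_int k) * of_int p / real q))
    = real q / 2 * ((rho (of_int k * of_int p / real q))\<^sup>2 - 1 / 4) + real q / 12 + 1 / (6 * real q)"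
proof -
  define u where "u = frac (of_int k * of_int p / real q)"
  define a where "a = (\<lambda>n. rho (real n * of_int p / real q))"
  define b where "b = (\<lambda>n. rho ((real n - of_int k) * of_int p / real q))"
  have shift: "(\<Sum>n<q. F (b n)) = (\<Sum>n<q. F (a n))" for F :: "real \<Rightarrow> real"
    using sum_periodic_affine[of "\<lambda>n. F (rho (of_int n * of_int p / real q))" q 1 "- k", OF _ q]
    by (simp add: a_def b_def rho_mod[OF q] q)
  have sq: "(\<Sum>n<q. (a n)\<^sup>2) = real q / 12 + 1 / (6 * real q)"
    using sum_rho_mult[OF q cop, of "\<lambda>x. x\<^sup>2"] sum_rho_sq[OF q] by (simp add: a_def)
  have d: "(a n - b n)\<^sup>2 = (a n - b n) * (1 - 2 * u) + u * (1 - u)" for n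
    using rho_diff_sq[of "real n * of_int p / real q" "of_int k * of_int p / real q"]
    by (simp add: a_def b_def u_def left_diff_distrib diff_divide_distrib)
  \<comment> \<open>Polarisation brings in the squared difference, to which the quadratic relation
    applies.\<close>
  have "(\<Sum>n<q. a n * b n) = (\<Sum>n<q. ((a n)\<^sup>2 + (b n)\<^sup>2 - (a n - b n)\<^sup>2) / 2)"
    by (intro sum.cong) (simp_all add: power2_eq_square algebra_simps)
  also have "\<dots> = (\<Sum>n<q. ((a n)\<^sup>2 + (b n)\<^sup>2 - ((a n - b n) * (1 - 2 * u) + u * (1 - u))) / 2)"
    by (simp only: d)
  also have "\<dots> = ((\<Sum>n<q. (a n)\<^sup>2) + (\<Sum>n<q. (b n)\<^sup>2)
      - (((\<Sum>n<q. a n) - (\<Sum>n<q. b n)) * (1 - 2 * u) + real q * (u * (1 - u)))) / 2"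
    by (simp add: sum.distrib sum_subtractf flip: sum_divide_distrib sum_distrib_right)
  \<comment> \<open>The shift by \<open>k\<close> changes neither the sum of values nor that of
    squares, so the term linear in \<open>a n - b n\<close> drops out.\<close>
  also have "\<dots> = (2 * (real q / 12 + 1 / (6 * real q)) - real q * (u * (1 - u))) / 2"
    using shift[of "\<lambda>x. x"] shift[of "\<lambda>x. x\<^sup>2"] sq by simp
  also have "\<dots> = real q / 2 * ((rho (of_int k * of_int p / real q))\<^sup>2 - 1 / 4) + real q / 12 + 1 / (6 * real q)"
    using q unfolding rho_def u_def[symmetric] by (simp add: power2_eq_square field_simps)
  finally show ?thesis unfolding a_def b_def .
qed

section \<open>The finite Fourier series of the squared sawtooth\<close>

lemma sin_pi_div_nonzero:
  assumes "\<not> int q dvd k" "q \<ge> 1"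
  shows "sin (pi * of_int k / real q) \<noteq> 0"
proof
  assume "sin (pi * of_int k / real q) = 0"
  then obtain i where "pi * of_int k / real q = of_int i * pi"
    by (auto simp: sin_zero_iff_int2)
  then have "real_of_int k = of_int (i * int q)" using assms(2) by (simp add: field_simps)
  then have "k = i * int q" by (simp only: of_int_eq_iff)
  then show False using assms(1) by simp
qed

lemma sin_pi_lattice_nonzero:
  assumes "r \<in> {1..<q}"
  shows "sin (pi * real r / real q) \<noteq> 0"
  using sin_pi_div_nonzero[of q "int r"] assms by (auto simp: nat_dvd_not_less)

lemma cos_int_period:
  assumes "q \<ge> 1"
  shows "cos (2 * pi * of_int (k mod int q) / real q) = cos (2 * pi * of_int k / real q)"
proof -
  have "real_of_int k = of_int (k mod int q) + real q * of_int (k div int q)"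
    by (metis mod_mult_div_eq of_int_add of_int_mult of_int_of_nat_eq)
  then have "2 * pi * of_int k / real q
      = 2 * pi * of_int (k mod int q) / real q + 2 * pi * of_int (k div int q)"
    using assms by (simp add: field_simps)
  then show ?thesis
    by (simp add: cos_add)
qed

lemma cos_double_sin_sq: "cos (2 * pi * x / y) = 1 - 2 * (sin (pi * x / y))\<^sup>2"
  using cos_double_sin[of "pi * x / y"] by (simp add: mult.assoc)

lemma sum_cos_root_of_unity:
  assumes q: "q \<ge> 1"
  shows "(\<Sum>r<q. cos (2 * pi * of_int (m * int r) / real q)) = (if int q dvd m then real q else 0)"
proof (cases "int q dvd m")
  case True
  then obtain z where "m = int q * z" by auto
  then have "2 * pi * of_int (m * int r) / real q = 2 * pi * of_int (z * int r)" for r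
    using q by simp
  then have "cos (2 * pi * of_int (m * int r) / real q) = 1" for r
    by (simp only: cos_int_2pin)
  then show ?thesis using True by simp
next
  case False
  define x where "x = pi * of_int m / real q"
  have nz: "sin x \<noteq> 0" using sin_pi_div_nonzero[OF False q] by (simp add: x_def)
  \<comment> \<open>Multiplied by 2 sin x, each cosine becomes a difference of sines at consecutive
    odd multiples of x, so the sum telescopes.\<close>
  have "2 * sin x * (\<Sum>r<n. cos (2 * x * real r)) = sin ((2 * real n - 1) * x) + sin x" for n
  proof (induction n)
    case (Suc n)
    have "2 * (sin x * cos (2 * x * real n)) = sin ((2 * real n + 1) * x) - sin ((2 * real n - 1) * x)"
    proof -
      have "(2 * real n + 1) * x = 2 * x * real n + x" "(2 * real n - 1) * x = 2 * x * real n - x"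
        by (simp_all add: algebra_simps)
      then show ?thesis by (simp only: sin_add sin_diff) simp
    qed
    with Suc show ?case by (simp add: algebra_simps)
  qed (simp add: sin_minus)
  \<comment> \<open>At n = q the argument (2 q - 1) x is 2 pi m - x, and the two sines
    cancel.\<close>
  from this[of q] have "2 * sin x * (\<Sum>r<q. cos (2 * x * real r)) = sin (2 * pi * of_int m - x) + sin x"
    using q by (simp add: x_def algebra_simps add_divide_distrib diff_divide_distrib)
  also have "\<dots> = 0" by (simp add: sin_diff)
  finally have "(\<Sum>r<q. cos (2 * x * real r)) = 0" using nz by simp
  then show ?thesis using False by (simp add: x_def mult.assoc)
qed

section \<open>The cosine series with squared cosecant coefficients\<close>

lemma sum_atLeast1_lessThan:
  fixes f :: "nat \<Rightarrow> real"
  assumes "q \<ge> 1" shows "(\<Sum>r=1..<q. f r) = (\<Sum>r<q. f r) - f 0"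
proof -
  have "{..<q} = insert 0 {1..<q}" using assms by auto
  then show ?thesis by simp
qed

text \<open>A finite Fourier series without the term r = 0. The index is an integer so that second
  differences can be taken at 0 as well.\<close>

definition cos_csc_sum :: "nat \<Rightarrow> int \<Rightarrow> real" where
  "cos_csc_sum q j = (\<Sum>r=1..<q. cos (2 * pi * of_int (j * int r) / real q) / (sin (pi * real r / real q))\<^sup>2)"

text \<open>In j, the second difference of cos(2 pi j r / q) is -4 sin^2(pi r / q) times that
  cosine, which cancels the denominator. There remains -4 times a cosine sum lacking its term r = 0,
  whence the additional 4.\<close>

lemma cos_csc_sum_second_difference:
  assumes q: "q \<ge> 1"
  shows "cos_csc_sum q (j + 1) + cos_csc_sum q (j - 1) - 2 * cos_csc_sum q j
    = (if int q dvd j then 4 - 4 * real q else 4)"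
proof -
  have "cos_csc_sum q (j + 1) + cos_csc_sum q (j - 1) - 2 * cos_csc_sum q j
      = (\<Sum>r=1..<q. - 4 * cos (2 * pi * of_int (j * int r) / real q))"
    unfolding cos_csc_sum_def sum_distrib_left sum.distrib[symmetric] sum_subtractf[symmetric]
  proof (rule sum.cong, rule refl)
    fix r assume r: "r \<in> {1..<q}"
    let ?A = "2 * pi * of_int (j * int r) / real q" and ?B = "2 * pi * real r / real q"
      and ?s = "sin (pi * real r / real q)"
    have nz: "?s \<noteq> 0"
      using sin_pi_lattice_nonzero[OF r] .
    have "2 * pi * of_int ((j + 1) * int r) / real q = ?A + ?B"
         "2 * pi * of_int ((j - 1) * int r) / real q = ?A - ?B"
      by (simp_all add: algebra_simps add_divide_distrib diff_divide_distrib)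
    then have E: "cos (2 * pi * of_int ((j + 1) * int r) / real q)
         + cos (2 * pi * of_int ((j - 1) * int r) / real q) - 2 * cos ?A = - 4 * cos ?A * ?s\<^sup>2"
      by (simp only: cos_add cos_diff cos_double_sin_sq[of "real r"]) (simp add: algebra_simps)
    show "cos (2 * pi * of_int ((j + 1) * int r) / real q) / ?s\<^sup>2
         + cos (2 * pi * of_int ((j - 1) * int r) / real q) / ?s\<^sup>2 - 2 * (cos ?A / ?s\<^sup>2) = - 4 * cos ?A"
      unfolding times_divide_eq_right add_divide_distrib[symmetric] diff_divide_distrib[symmetric] E
      using nz by simp
  qed
  also have "\<dots> = (if int q dvd j then 4 - 4 * real q else 4)"
    unfolding sum_distrib_left[symmetric] sum_atLeast1_lessThan[OF q] sum_cos_root_of_unity[OF q]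
    by simp
  finally show ?thesis .
qed

text \<open>The constant second difference 4 for 0 < j < q forces a quadratic with leading
  coefficient 2; evenness and the exceptional second difference at 0 give the linear
  coefficient.\<close>

lemma cos_csc_sum_quadratic:
  assumes q: "q \<ge> 1" and "j \<le> q"
  shows "cos_csc_sum q (int j) = cos_csc_sum q 0 - 2 * real q * real j + 2 * (real j)\<^sup>2"
  using \<open>j \<le> q\<close>
proof (induction j rule: less_induct)
  case (less j)
  have even: "cos_csc_sum q (- 1) = cos_csc_sum q 1"
    by (simp add: cos_csc_sum_def)
  consider "j = 0" | "j = 1" | i where "j = Suc i" "i \<ge> 1" by (cases j) force+
  then show ?case
  proof cases
    case 2
    \<comment> \<open>By evenness the second difference at 0 is twice the first step, so that step
      equals 2 - 2 q.\<close>
    with cos_csc_sum_second_difference[OF q, of 0] even show ?thesis by simp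
  next
    case 3
    have "\<not> int q dvd int i" using 3 less.prems by (auto simp: nat_dvd_not_less)
    moreover have "int i + 1 = int j" "int i - 1 = int (i - 1)" "real j = real i + 1" "real (i - 1) = real i - 1"
      using 3 by auto
    moreover have "i - 1 < j" "i < j" "i - 1 \<le> q" "i \<le> q" using 3 less.prems by auto
    ultimately show ?thesis
      using cos_csc_sum_second_difference[OF q, of "int i"] less.IH[of i] less.IH[of "i - 1"]
      by (simp add: power2_eq_square algebra_simps \<open>j = Suc i\<close>)
  qed simp
qed

text \<open>Over a full period the series sums to zero, as it has no term r = 0. Summing its
  quadratic form then determines the constant coefficient.\<close>

lemma sum_csc_sq:
  assumes q: "q \<ge> 1"
  shows "cos_csc_sum q 0 = ((real q)\<^sup>2 - 1) / 3"
proof -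
  have "(\<Sum>j<q. cos_csc_sum q (int j))
    = (\<Sum>r=1..<q. (\<Sum>j<q. cos (2 * pi * of_int (int r * int j) / real q)) / (sin (pi * real r / real q))\<^sup>2)"
    unfolding cos_csc_sum_def sum_divide_distrib by (subst sum.swap) (simp add: mult.commute)
  also have "\<dots> = 0"
  proof (rule sum.neutral, rule ballI)
    fix r assume "r \<in> {1..<q}"
    then have "\<not> int q dvd int r" by (auto dest: zdvd_imp_le)
    then show "(\<Sum>j<q. cos (2 * pi * of_int (int r * int j) / real q)) / (sin (pi * real r / real q))\<^sup>2 = 0"
      unfolding sum_cos_root_of_unity[OF q] by simp
  qed
  finally have "0 = (\<Sum>j<q. cos_csc_sum q 0 - 2 * real q * real j + 2 * (real j)\<^sup>2)"
    using cos_csc_sum_quadratic[OF q] by simp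
  also have "\<dots> = real q * cos_csc_sum q 0 - 2 * real q * (\<Sum>j<q. real j) + 2 * (\<Sum>j<q. (real j)\<^sup>2)"
    by (simp add: sum.distrib sum_subtractf sum_distrib_left)
  also have "\<dots> = real q * (cos_csc_sum q 0 - ((real q)\<^sup>2 - 1) / 3)"
    unfolding sum_nat_real sum_nat_sq_real by (simp add: field_simps power2_eq_square)
  finally show ?thesis using q by simp
qed

lemma cos_csc_sum_mod:
  assumes "q \<ge> 1"
  shows "cos_csc_sum q (j mod int q) = cos_csc_sum q j"
proof -
  have "cos (2 * pi * of_int ((j mod int q) * int r) / real q) = cos (2 * pi * of_int (j * int r) / real q)" for r
    using cos_int_period[OF assms, of "(j mod int q) * int r"] cos_int_period[OF assms, of "j * int r"]
    by (simp only: mod_mult_left_eq)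
  then show ?thesis unfolding cos_csc_sum_def by (simp only:)
qed

text \<open>For 0 <= i < q the square 1/4 - i/q + (i/q)^2 is, up to a constant, the quadratic of
  \<open>cos_csc_sum_quadratic\<close> divided by 2 q^2. The constant is the mean of the squared
  sawtooth over the residues.\<close>

lemma rho_sq_fourier:
  assumes q: "q \<ge> 1"
  shows "(rho (of_int j / real q))\<^sup>2 = 1 / 12 + 1 / (6 * (real q)\<^sup>2) + cos_csc_sum q j / (2 * (real q)\<^sup>2)"
proof -
  define i where "i = nat (j mod int q)"
  have i: "int i = j mod int q" "i < q" using q by (simp_all add: i_def nat_less_iff)
  have "rho (of_int j / real q) = rho (real i / real q)"
    using rho_mod1[OF q, of j] i(1) by (metis of_int_of_nat_eq)
  moreover have "cos_csc_sum q j = cos_csc_sum q (int i)"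
    using cos_csc_sum_mod[OF q, of j] i(1) by simp
  ultimately show ?thesis
    using q i(2) by (simp add: rho_lattice cos_csc_sum_quadratic[OF q] sum_csc_sq[OF q])
      (simp add: field_simps power2_eq_square)
qed

text \<open>The product of cosines splits into the frequencies r - s and r + s. Only the residues of
  s and -s contribute, each with half of the coefficient at s; \<open>w\<close> is this half, scaled
  by \<open>q\<close>.\<close>

lemma sum_cos_csc_orthogonality:
  assumes q: "q \<ge> 1" and s: "\<not> int q dvd s"
  shows "(\<Sum>k<q. cos_csc_sum q (int k) * cos (2 * pi * of_int (s * int k) / real q))
    = real q / (sin (pi * of_int s / real q))\<^sup>2"
proof -
  define w where "w = (\<lambda>r. real q / (2 * (sin (pi * real r / real q))\<^sup>2))"
  have pick: "(\<Sum>r=1..<q. if int q dvd int r - t then w r else 0)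
      = real q / (2 * (sin (pi * of_int t / real q))\<^sup>2)" if t: "\<not> int q dvd t" for t
  proof -
    define i where "i = nat (t mod int q)"
    have i: "int i = t mod int q" "i < q" using q by (simp_all add: i_def nat_less_iff)
    have "i \<noteq> 0" using t i(1) by (auto simp: dvd_eq_mod_eq_0)
    have "(int q dvd int r - t) = (r = i)" if "r < q" for r
      using that i by (auto simp: mod_eq_dvd_iff[symmetric])
    then have "(\<Sum>r=1..<q. if int q dvd int r - t then w r else 0) = (\<Sum>r=1..<q. if r = i then w r else 0)"
      by (intro sum.cong) auto
    also have "\<dots> = w i" using \<open>i < q\<close> \<open>i \<noteq> 0\<close> by simp
    \<comment> \<open>As a function of t, sin(pi t / q) has period q only up to sign; its square is
      handled through the cosine of the double angle, which does have period q.\<close>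
    also have "\<dots> = real q / (2 * (sin (pi * of_int t / real q))\<^sup>2)"
      using cos_int_period[OF q, of t] i(1) unfolding w_def cos_double_sin_sq
      by (metis (no_types, opaque_lifting) cancel_comm_monoid_add_class.diff_cancel diff_eq_eq diff_left_imp_eq mult_left_cancel of_int_of_nat_eq zero_neq_numeral)
    finally show ?thesis .
  qed
  have "(\<Sum>k<q. cos_csc_sum q (int k) * cos (2 * pi * of_int (s * int k) / real q))
     = (\<Sum>r=1..<q. (\<Sum>k<q. cos (2 * pi * of_int (int k * int r) / real q) * cos (2 * pi * of_int (s * int k) / real q))
         / (sin (pi * real r / real q))\<^sup>2)"
    unfolding cos_csc_sum_def sum_divide_distrib sum_distrib_right by (subst sum.swap) simp
  also have "\<dots> = (\<Sum>r=1..<q. ((if int q dvd int r - s then w r else 0) + (if int q dvd int r - (- s) then w r else 0)))"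
  proof (rule sum.cong, rule refl)
    fix r
    have "cos (2 * pi * of_int (int k * int r) / real q) * cos (2 * pi * of_int (s * int k) / real q)
        = (cos (2 * pi * of_int ((int r - s) * int k) / real q) + cos (2 * pi * of_int ((int r - (- s)) * int k) / real q)) / 2" for k
      unfolding cos_times_cos
      by (simp add: algebra_simps add_divide_distrib diff_divide_distrib)
    then have E: "(\<Sum>k<q. cos (2 * pi * of_int (int k * int r) / real q) * cos (2 * pi * of_int (s * int k) / real q))
       = ((\<Sum>k<q. cos (2 * pi * of_int ((int r - s) * int k) / real q))
           + (\<Sum>k<q. cos (2 * pi * of_int ((int r - (- s)) * int k) / real q))) / 2"
      by (simp only: sum.distrib flip: sum_divide_distrib)
    show "(\<Sum>k<q. cos (2 * pi * of_int (int k * int r) / real q) * cos (2 * pi * of_int (s * int k) / real q))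
         / (sin (pi * real r / real q))\<^sup>2
       = (if int q dvd int r - s then w r else 0) + (if int q dvd int r - (- s) then w r else 0)"
      unfolding E sum_cos_root_of_unity[OF q] w_def by (simp add: add_divide_distrib)
  qed
  also have "\<dots> = real q / (sin (pi * of_int s / real q))\<^sup>2"
    unfolding sum.distrib using pick[of s] pick[of "- s"] s by simp
  finally show ?thesis .
qed

text \<open>A Parseval identity. Since \<open>c\<close> is the mean of the squared sawtooth, the
  cosine series sum to zero and only their product survives beside the constant term.\<close>

lemma sum_rho_sq_rho_sq:
  assumes q: "q \<ge> 1" and cop: "coprime p (int q)"
  shows "(\<Sum>k<q. (rho (real k / real q))\<^sup>2 * (rho (real k * of_int p / real q))\<^sup>2)
    = (real q / 12 + 1 / (6 * real q))\<^sup>2 / real q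
      + 1 / (4 * real q ^ 3) * (\<Sum>r=1..<q. 1 /
            ((sin (pi * real r / real q))\<^sup>2 * (sin (pi * real r * of_int p / real q))\<^sup>2))"
proof -
  define c where "c = 1 / 12 + 1 / (6 * (real q)\<^sup>2)"
  let ?C = "cos_csc_sum q"
  have f: "(rho (of_int j / real q))\<^sup>2 = c + ?C j / (2 * (real q)\<^sup>2)" for j
    using rho_sq_fourier[OF q, of j] by (simp add: c_def)
  have f1: "(rho (real k / real q))\<^sup>2 = c + ?C (int k) / (2 * (real q)\<^sup>2)" for k
    using f[of "int k"] by simp
  have f2: "(rho (real k * of_int p / real q))\<^sup>2 = c + ?C (int k * p) / (2 * (real q)\<^sup>2)" for k
    using f[of "int k * p"] by simp
  have "(\<Sum>k<q. c + ?C (int k) / (2 * (real q)\<^sup>2)) = real q * c"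
    using sum_rho_sq[OF q] q unfolding f1 by (simp add: c_def field_simps power2_eq_square)
  then have z1: "(\<Sum>k<q. ?C (int k)) = 0"
    using q by (simp add: sum.distrib flip: sum_divide_distrib)
  have z2: "(\<Sum>k<q. ?C (int k * p)) = 0"
    using sum_periodic_affine[of ?C q p 0] z1 q cop by (simp add: cos_csc_sum_mod mult.commute)
  \<comment> \<open>Only the series at \<open>int k * p\<close> is expanded. Its terms are cosines
    in k of frequency r p, and orthogonality evaluates the other series against each of
    them.\<close>
  have "(\<Sum>k<q. ?C (int k) * ?C (int k * p))
      = (\<Sum>k<q. \<Sum>r=1..<q. ?C (int k) * cos (2 * pi * of_int ((int r * p) * int k) / real q) / (sin (pi * real r / real q))\<^sup>2)"
    unfolding cos_csc_sum_def[of q "int _ * p"] sum_distrib_left by (simp add: ac_simps)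
  also have "\<dots> = (\<Sum>r=1..<q. (\<Sum>k<q. ?C (int k) * cos (2 * pi * of_int ((int r * p) * int k) / real q)) / (sin (pi * real r / real q))\<^sup>2)"
    unfolding sum_divide_distrib by (rule sum.swap)
  also have "\<dots> = (\<Sum>r=1..<q. (real q / (sin (pi * of_int (int r * p) / real q))\<^sup>2) / (sin (pi * real r / real q))\<^sup>2)"
  proof (rule sum.cong, rule refl)
    fix r assume r: "r \<in> {1..<q}"
    have "\<not> int q dvd int r * p"
      using r cop by (auto simp: coprime_dvd_mult_left_iff coprime_commute dest: zdvd_imp_le)
    from sum_cos_csc_orthogonality[OF q this]
    show "(\<Sum>k<q. ?C (int k) * cos (2 * pi * of_int ((int r * p) * int k) / real q)) / (sin (pi * real r / real q))\<^sup>2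
      = (real q / (sin (pi * of_int (int r * p) / real q))\<^sup>2) / (sin (pi * real r / real q))\<^sup>2" by simp
  qed
  also have "\<dots> = real q * (\<Sum>r=1..<q. 1 /
            ((sin (pi * real r / real q))\<^sup>2 * (sin (pi * real r * of_int p / real q))\<^sup>2))"
    unfolding sum_distrib_left by (simp add: field_simps)
  finally have CC: "(\<Sum>k<q. ?C (int k) * ?C (int k * p)) = real q * (\<Sum>r=1..<q. 1 /
            ((sin (pi * real r / real q))\<^sup>2 * (sin (pi * real r * of_int p / real q))\<^sup>2))" .
  have "(\<Sum>k<q. (rho (real k / real q))\<^sup>2 * (rho (real k * of_int p / real q))\<^sup>2)
    = (\<Sum>k<q. c\<^sup>2 + c / (2 * (real q)\<^sup>2) * ?C (int k) + c / (2 * (real q)\<^sup>2) * ?C (int k * p)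
         + 1 / (4 * real q ^ 4) * (?C (int k) * ?C (int k * p)))"
    unfolding f1 f2 using q
    by (intro sum.cong) (simp_all add: field_simps power2_eq_square power4_eq_xxxx)
  also have "\<dots> = real q * c\<^sup>2 + 1 / (4 * real q ^ 4) * (\<Sum>k<q. ?C (int k) * ?C (int k * p))"
    unfolding sum.distrib sum_distrib_left[symmetric] z1 z2 by simp
  also have "real q * c\<^sup>2 = (real q / 12 + 1 / (6 * real q))\<^sup>2 / real q"
    using q by (simp add: c_def field_simps power2_eq_square)
  finally show ?thesis
    unfolding CC using q by (simp add: power3_eq_cube power4_eq_xxxx)
qed

text \<open>Writing cos^2 as 1 - sin^2 makes the numerator 3 - 2 sin^2, whose second part cancels
  the factor containing \<open>p\<close> and leaves the sum from \<open>sum_csc_sq\<close>.\<close>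

lemma sum_cos_sq_csc_sq:
  assumes q: "q \<ge> 1" and cop: "coprime p (int q)"
  shows "(\<Sum>r=1..<q. (1 + 2 * (cos (pi * real r * of_int p / real q))\<^sup>2) /
            ((sin (pi * real r / real q))\<^sup>2 * (sin (pi * real r * of_int p / real q))\<^sup>2))
    = 3 * (\<Sum>r=1..<q. 1 /
            ((sin (pi * real r / real q))\<^sup>2 * (sin (pi * real r * of_int p / real q))\<^sup>2))
      - 2 * ((real q)\<^sup>2 - 1) / 3"
proof -
  have "(1 + 2 * (cos (pi * real r * of_int p / real q))\<^sup>2) /
            ((sin (pi * real r / real q))\<^sup>2 * (sin (pi * real r * of_int p / real q))\<^sup>2)
    = 3 * (1 / ((sin (pi * real r / real q))\<^sup>2 * (sin (pi * real r * of_int p / real q))\<^sup>2))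
      - 2 * (1 / (sin (pi * real r / real q))\<^sup>2)" if r: "r \<in> {1..<q}" for r
  proof -
    have "\<not> int q dvd int r * p"
      using r cop by (auto simp: coprime_dvd_mult_left_iff coprime_commute dest: zdvd_imp_le)
    from sin_pi_div_nonzero[OF this q] have "sin (pi * real r * of_int p / real q) \<noteq> 0"
      by (simp add: mult.assoc)
    moreover have "sin (pi * real r / real q) \<noteq> 0"
      using sin_pi_lattice_nonzero[OF r] .
    ultimately show ?thesis
      unfolding cos_squared_eq by (simp add: field_simps)
  qed
  then have "(\<Sum>r=1..<q. (1 + 2 * (cos (pi * real r * of_int p / real q))\<^sup>2) /
            ((sin (pi * real r / real q))\<^sup>2 * (sin (pi * real r * of_int p / real q))\<^sup>2))
    = 3 * (\<Sum>r=1..<q. 1 /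
            ((sin (pi * real r / real q))\<^sup>2 * (sin (pi * real r * of_int p / real q))\<^sup>2))
      - 2 * cos_csc_sum q 0"
    by (simp add: cos_csc_sum_def sum_subtractf sum_distrib_left)
  then show ?thesis by (simp add: sum_csc_sq[OF q])
qed

section \<open>Double sums over the lattice\<close>

text \<open>The substitution m = n - k frees the squared factor from n; the sum over n is then an
  autocorrelation of the sawtooth.\<close>

lemma sum_rho_rho_rho_sq_diff:
  assumes q: "q \<ge> 1" and cop: "coprime p (int q)" "coprime p' (int q)"
  shows "(\<Sum>n<q. \<Sum>m<q. rho (real n * of_int p / real q) * rho (real m * of_int p / real q)
            * (rho ((real n - real m) * of_int p' / real q))\<^sup>2)
    = (\<Sum>k<q. (real q / 2 * ((rho (real k * of_int p / real q))\<^sup>2 - 1 / 4) + real q / 12 + 1 / (6 * real q))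
            * (rho (real k * of_int p' / real q))\<^sup>2)"
proof -
  have "(\<Sum>m<q. rho (real m * of_int p / real q) * (rho ((real n - real m) * of_int p' / real q))\<^sup>2)
     = (\<Sum>k<q. rho ((real n - real k) * of_int p / real q) * (rho (real k * of_int p' / real q))\<^sup>2)" for n
  proof -
    let ?g = "\<lambda>k. rho (of_int (int n - k) * of_int p / real q) * (rho (of_int k * of_int p' / real q))\<^sup>2"
    have "?g (k mod int q) = ?g k" for k
      using rho_mod[OF q, of "int n - k mod int q" p] rho_mod[OF q, of "int n - k" p]
      by (simp only: rho_mod[OF q] mod_diff_right_eq)
    from sum_periodic_affine[of ?g, OF this q, of "- 1" "int n"] show ?thesis
      by (simp add: algebra_simps)
  qed
  then have "(\<Sum>n<q. \<Sum>m<q. rho (real n * of_int p / real q) * rho (real m * of_int p / real q)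
            * (rho ((real n - real m) * of_int p' / real q))\<^sup>2)
     = (\<Sum>n<q. \<Sum>k<q. rho (real n * of_int p / real q) * rho ((real n - real k) * of_int p / real q)
            * (rho (real k * of_int p' / real q))\<^sup>2)"
    by (simp only: mult.assoc sum_distrib_left[symmetric])
  also have "\<dots> = (\<Sum>k<q. (\<Sum>n<q. rho (real n * of_int p / real q) * rho ((real n - real k) * of_int p / real q))
            * (rho (real k * of_int p' / real q))\<^sup>2)"
    unfolding sum_distrib_right by (rule sum.swap)
  finally show ?thesis
    using rho_autocorrelation[OF q cop(1), of "int _"] by simp
qed

section \<open>Reindexing and splitting of double sums\<close>

lemma sum_periodic_diff:
  fixes F :: "int \<Rightarrow> real"
  assumes per: "\<And>k. F (k mod int q) = F k" and q: "q \<ge> 1"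
  shows "(\<Sum>m<q. F (int n - int m)) = (\<Sum>k<q. F (int k))"
    and "(\<Sum>m<q. F (int m - int n)) = (\<Sum>k<q. F (int k))"
  using sum_periodic_affine[of F, OF per q, of "- 1" "int n"]
        sum_periodic_affine[of F, OF per q, of 1 "- int n"]
  by simp_all

lemma double_sum_cmult: "(\<Sum>n\<in>A. \<Sum>m\<in>A. c * F n m) = (c :: real) * (\<Sum>n\<in>A. \<Sum>m\<in>A. F n m)"
  by (simp flip: sum_distrib_left)

lemma double_sum_outer: "(\<Sum>n<q. \<Sum>m<q. f n) = real q * (\<Sum>n<q. f n)" for f :: "nat \<Rightarrow> real"
  by (simp flip: sum_distrib_left)

lemma double_sum_inner: "(\<Sum>n<q. \<Sum>m<q. f m) = real q * (\<Sum>n<q. f n)" for f :: "nat \<Rightarrow> real"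
  by simp

lemma double_sum_times: "(\<Sum>n\<in>A. \<Sum>m\<in>A. f n * g m) = (\<Sum>n\<in>A. f n) * (\<Sum>n\<in>A. g n :: real)"
  "(\<Sum>n\<in>A. \<Sum>m\<in>A. f m * g n) = (\<Sum>n\<in>A. f n) * (\<Sum>n\<in>A. g n)"
  by (simp_all flip: sum_distrib_left sum_distrib_right)

section \<open>The sums that occur in the expanded kernels\<close>

locale lattice_sums =
  fixes q :: nat and p :: int
  assumes q: "q \<ge> 1" and cop: "coprime p (int q)"
begin

text \<open>The letters a and b refer to the first and second coordinate of the n-th point. As
  \<open>rho\<close> has period 1, the second coordinate need not be reduced modulo 1 here.\<close>

definition "ra n = rho (real n / real q)"
definition "rb n = rho (real n * of_int p / real q)"
definition "ka n m = (rho ((real n - real m) / real q))\<^sup>2"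
definition "kb n m = (rho ((real n - real m) * of_int p / real q))\<^sup>2"
text \<open>Closed form of the sum of the squared sawtooth over all residues, hence the same for
  both coordinates.\<close>

definition "sq_sum = real q / 12 + 1 / (6 * real q)"
definition "sq_corr = (\<Sum>k<q. (ra k)\<^sup>2 * (rb k)\<^sup>2)"

lemma sum_ra: "(\<Sum>n<q. ra n) = 1 / 2" and sum_rb: "(\<Sum>n<q. rb n) = 1 / 2"
  and sum_ra_sq: "(\<Sum>n<q. (ra n)\<^sup>2) = sq_sum" and sum_rb_sq: "(\<Sum>n<q. (rb n)\<^sup>2) = sq_sum"
  using sum_rho[OF q] sum_rho_sq[OF q] sum_rho_mult[OF q cop, of "\<lambda>x. x"]
    sum_rho_mult[OF q cop, of "\<lambda>x. x\<^sup>2"]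
  by (simp_all add: ra_def rb_def sq_sum_def)

lemma sum_ra_rb_sq: "(\<Sum>n<q. ra n * (rb n)\<^sup>2) = 1 / 8"
  and sum_ra_sq_rb: "(\<Sum>n<q. (ra n)\<^sup>2 * rb n) = 1 / 8"
  using sum_rho_odd[OF q _ cop, of 1] sum_rho_odd[OF q cop, of 1]
  by (simp_all add: ra_def rb_def mult.commute)

text \<open>The Dedekind sum starts at k = 1, and the term k = 0 contributes (1/2)^2.\<close>

lemma sum_ra_rb: "(\<Sum>n<q. ra n * rb n) = inhom_dedekind_sum p q + 1 / 4"
  unfolding inhom_dedekind_sum_def sum_atLeast1_lessThan[OF q] ra_def rb_def
  by (simp add: rho_def)

lemma rho_sq_mod: "(rho (of_int (k mod int q) / real q))\<^sup>2 = (rho (of_int k / real q))\<^sup>2"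
  "(rho (of_int (k mod int q) * of_int p / real q))\<^sup>2 = (rho (of_int k * of_int p / real q))\<^sup>2"
  by (simp_all add: rho_mod1[OF q] rho_mod[OF q])

lemma sum_ka: "(\<Sum>m<q. ka n m) = sq_sum" "(\<Sum>n<q. ka n m) = sq_sum"
  using sum_periodic_diff[of "\<lambda>k. (rho (of_int k / real q))\<^sup>2", OF rho_sq_mod(1) q] sum_ra_sq
  by (simp_all add: ka_def ra_def)

lemma sum_kb: "(\<Sum>m<q. kb n m) = sq_sum" "(\<Sum>n<q. kb n m) = sq_sum"
  using sum_periodic_diff[of "\<lambda>k. (rho (of_int k * of_int p / real q))\<^sup>2", OF rho_sq_mod(2) q] sum_rb_sq
  by (simp_all add: kb_def rb_def)

lemma sum_ka_kb: "(\<Sum>n<q. \<Sum>m<q. ka n m * kb n m) = real q * sq_corr"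
proof -
  have "(\<Sum>m<q. ka n m * kb n m) = sq_corr" for n
    using sum_periodic_diff(1)[of "\<lambda>k. (rho (of_int k / real q))\<^sup>2 * (rho (of_int k * of_int p / real q))\<^sup>2", OF _ q, of n]
    unfolding rho_sq_mod by (simp add: sq_corr_def ka_def kb_def ra_def rb_def)
  then show ?thesis by simp
qed

text \<open>All row and column sums of \<open>ka\<close> are equal, so a factor depending on one
  index alone separates.\<close>

lemma sum_f_ka: "(\<Sum>n<q. \<Sum>m<q. f n * ka n m) = (\<Sum>n<q. f n) * sq_sum"
  "(\<Sum>n<q. \<Sum>m<q. f m * ka n m) = (\<Sum>n<q. f n) * sq_sum"
  by (simp add: sum_ka flip: sum_distrib_left sum_distrib_right)
    (subst sum.swap, simp add: sum_ka flip: sum_distrib_left sum_distrib_right)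

lemma sum_f_kb: "(\<Sum>n<q. \<Sum>m<q. f n * kb n m) = (\<Sum>n<q. f n) * sq_sum"
  "(\<Sum>n<q. \<Sum>m<q. f m * kb n m) = (\<Sum>n<q. f n) * sq_sum"
  by (simp add: sum_kb flip: sum_distrib_left sum_distrib_right)
    (subst sum.swap, simp add: sum_kb flip: sum_distrib_left sum_distrib_right)

text \<open>Summed over pairs with a fixed difference, \<open>ra n * ra m\<close> is affine in the
  squared sawtooth at that difference, so \<open>sq_corr\<close> returns with weight q / 2.\<close>

lemma sum_ra_ra_kb: "(\<Sum>n<q. \<Sum>m<q. ra n * ra m * kb n m) = real q / 2 * sq_corr - real q * sq_sum / 8 + sq_sum\<^sup>2"
  and sum_rb_rb_ka: "(\<Sum>n<q. \<Sum>m<q. rb n * rb m * ka n m) = real q / 2 * sq_corr - real q * sq_sum / 8 + sq_sum\<^sup>2"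
proof -
  have "(\<Sum>n<q. \<Sum>m<q. ra n * ra m * kb n m) = (\<Sum>k<q. (real q / 2 * ((ra k)\<^sup>2 - 1 / 4) + sq_sum) * (rb k)\<^sup>2)"
    using sum_rho_rho_rho_sq_diff[OF q _ cop, of 1] by (simp add: ra_def rb_def kb_def sq_sum_def add.assoc)
  also have "\<dots> = (\<Sum>k<q. real q / 2 * ((ra k)\<^sup>2 * (rb k)\<^sup>2) + (sq_sum - real q / 8) * (rb k)\<^sup>2)"
    by (intro sum.cong) (simp_all add: algebra_simps)
  also have "\<dots> = real q / 2 * sq_corr + (sq_sum - real q / 8) * sq_sum"
    unfolding sum.distrib sum_distrib_left[symmetric] sq_corr_def sum_rb_sq ..
  finally show "(\<Sum>n<q. \<Sum>m<q. ra n * ra m * kb n m) = real q / 2 * sq_corr - real q * sq_sum / 8 + sq_sum\<^sup>2"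
    by (simp add: algebra_simps power2_eq_square)
  have "(\<Sum>n<q. \<Sum>m<q. rb n * rb m * ka n m) = (\<Sum>k<q. (real q / 2 * ((rb k)\<^sup>2 - 1 / 4) + sq_sum) * (ra k)\<^sup>2)"
    using sum_rho_rho_rho_sq_diff[OF q cop, of 1] by (simp add: ra_def rb_def ka_def sq_sum_def add.assoc)
  also have "\<dots> = (\<Sum>k<q. real q / 2 * ((ra k)\<^sup>2 * (rb k)\<^sup>2) + (sq_sum - real q / 8) * (ra k)\<^sup>2)"
    by (intro sum.cong) (simp_all add: algebra_simps)
  also have "\<dots> = real q / 2 * sq_corr + (sq_sum - real q / 8) * sq_sum"
    unfolding sum.distrib sum_distrib_left[symmetric] sq_corr_def sum_ra_sq ..
  finally show "(\<Sum>n<q. \<Sum>m<q. rb n * rb m * ka n m) = real q / 2 * sq_corr - real q * sq_sum / 8 + sq_sum\<^sup>2"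
    by (simp add: algebra_simps power2_eq_square)
qed

section \<open>Evaluation of the three kernel sums\<close>

lemma periodic_sum:
  "(\<Sum>n<q. \<Sum>m<q. (1 / 4 + ka n m) * (1 / 4 + kb n m)) - 2 * real q * (\<Sum>n<q. 1 / 3 * (1 / 3)) + (real q)\<^sup>2 * (1 / 3 * (1 / 3))
    = real q * sq_corr + real q * sq_sum / 2 - 7 / 144 * (real q)\<^sup>2"
proof -
  have "(\<Sum>n<q. \<Sum>m<q. (1 / 4 + ka n m) * (1 / 4 + kb n m))
     = (\<Sum>n<q. \<Sum>m<q. 1 / 16 + 1 / 4 * ka n m + 1 / 4 * kb n m + ka n m * kb n m)"
    by (intro sum.cong) (simp_all add: algebra_simps)
  also have "\<dots> = (real q)\<^sup>2 / 16 + real q * sq_sum / 2 + real q * sq_corr"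
    unfolding sum.distrib sum_distrib_left[symmetric] sum_ka sum_kb sum_ka_kb
    by (simp add: power2_eq_square)
  \<comment> \<open>The coefficient -7/144 is 1/16 - 2/9 + 1/9.\<close>
  finally show ?thesis by (simp add: power2_eq_square)
qed

text \<open>The one-point squares produce \<open>sq_corr\<close> a second time, through products
  taken at the same index, with total \<open>real q * sq_corr / 2\<close>. The single sum cancels
  exactly this contribution.\<close>

lemma extreme_sum:
  "(\<Sum>n<q. \<Sum>m<q. (1 / 8 + ka n m / 2 - (ra n)\<^sup>2 / 2 - (ra m)\<^sup>2 / 2) * (1 / 8 + kb n m / 2 - (rb n)\<^sup>2 / 2 - (rb m)\<^sup>2 / 2))
     - 2 * real q * (\<Sum>n<q. (1 / 8 - (ra n)\<^sup>2 / 2) * (1 / 8 - (rb n)\<^sup>2 / 2)) + (real q)\<^sup>2 * (1 / 12 * (1 / 12))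
    = real q * sq_corr / 4 - sq_sum\<^sup>2 / 2 + real q * sq_sum / 8 - 5 / 576 * (real q)\<^sup>2"
proof -
  have "(\<Sum>n<q. \<Sum>m<q. (1 / 8 + ka n m / 2 - (ra n)\<^sup>2 / 2 - (ra m)\<^sup>2 / 2) * (1 / 8 + kb n m / 2 - (rb n)\<^sup>2 / 2 - (rb m)\<^sup>2 / 2))
     = (\<Sum>n<q. \<Sum>m<q. 1 / 64 + 1 / 16 * ka n m + 1 / 16 * kb n m + 1 / 4 * (ka n m * kb n m)
       + (- 1 / 16) * ((ra n)\<^sup>2 + (rb n)\<^sup>2) + (- 1 / 16) * ((ra m)\<^sup>2 + (rb m)\<^sup>2)
       + (- 1 / 4) * ((ra n)\<^sup>2 * kb n m) + (- 1 / 4) * ((ra m)\<^sup>2 * kb n m)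
       + (- 1 / 4) * ((rb n)\<^sup>2 * ka n m) + (- 1 / 4) * ((rb m)\<^sup>2 * ka n m)
       + 1 / 4 * ((ra n)\<^sup>2 * (rb n)\<^sup>2) + 1 / 4 * ((ra n)\<^sup>2 * (rb m)\<^sup>2)
       + 1 / 4 * ((ra m)\<^sup>2 * (rb n)\<^sup>2) + 1 / 4 * ((ra m)\<^sup>2 * (rb m)\<^sup>2))"
    by (intro sum.cong) (simp_all add: field_simps)
  also have "\<dots> = (real q)\<^sup>2 / 64 + real q * sq_sum / 8 + real q * sq_corr / 4 - real q * sq_sum / 4 - sq_sum\<^sup>2 + real q * sq_corr / 2 + sq_sum\<^sup>2 / 2"
    unfolding sum.distrib double_sum_cmult sum_f_ka sum_f_kb double_sum_outer double_sum_inner double_sum_times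
      sum_ka sum_kb sum_ka_kb sum_ra_sq sum_rb_sq sq_corr_def[symmetric]
    by (simp add: power2_eq_square sum_ra_sq[unfolded power2_eq_square] sum_rb_sq[unfolded power2_eq_square])
  finally have pairs: "(\<Sum>n<q. \<Sum>m<q. (1 / 8 + ka n m / 2 - (ra n)\<^sup>2 / 2 - (ra m)\<^sup>2 / 2) * (1 / 8 + kb n m / 2 - (rb n)\<^sup>2 / 2 - (rb m)\<^sup>2 / 2)) = \<dots>" .
  have "(\<Sum>n<q. (1 / 8 - (ra n)\<^sup>2 / 2) * (1 / 8 - (rb n)\<^sup>2 / 2))
    = (\<Sum>n<q. 1 / 64 + (- 1 / 16) * (ra n)\<^sup>2 + (- 1 / 16) * (rb n)\<^sup>2 + 1 / 4 * ((ra n)\<^sup>2 * (rb n)\<^sup>2))"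
    by (intro sum.cong) (simp_all add: field_simps)
  also have "\<dots> = real q / 64 - sq_sum / 8 + sq_corr / 4"
    unfolding sum.distrib sum_distrib_left[symmetric] sum_ra_sq sum_rb_sq sq_corr_def by simp
  finally have points: "(\<Sum>n<q. (1 / 8 - (ra n)\<^sup>2 / 2) * (1 / 8 - (rb n)\<^sup>2 / 2)) = \<dots>" .
  show ?thesis unfolding pairs points by (simp add: power2_eq_square field_simps)
qed


text \<open>The part of the kernel \<open>1 - max s t\<close> that depends on one point only,
  without its constant 3/8.\<close>

definition "ha n = (ra n - (ra n)\<^sup>2) / 2"
definition "hb n = (rb n - (rb n)\<^sup>2) / 2"

text \<open>The products \<open>ra n * rb n * (ra m * rb m)\<close> sum to \<open>D\<^sup>2\<close>,
  and the mixed terms with \<open>ha\<close> and \<open>hb\<close> contribute \<open>D\<close>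
  linearly. Together they complete to the square of D + 1/2.\<close>

lemma standard_sum:
  "(\<Sum>n<q. \<Sum>m<q. (3 / 8 + ha n + ha m + ra n * ra m + ka n m / 2) * (3 / 8 + hb n + hb m + rb n * rb m + kb n m / 2))
     - 2 * real q * (\<Sum>n<q. (3 / 8 + ha n) * (3 / 8 + hb n)) + (real q)\<^sup>2 * (1 / 3 * (1 / 3))
    = 3 / 4 * real q * sq_corr + (inhom_dedekind_sum p q + 3 / 4)\<^sup>2 + sq_sum\<^sup>2 / 2 + real q * sq_sum / 4
      - 17 / 576 * (real q)\<^sup>2 - 1 / 16"
proof -
  \<comment> \<open>This includes the term n = 0, so it exceeds the inhomogeneous Dedekind sum by
    1/4, and D + 1/2 is the bracket of the claim.\<close>
  define D where "D = (\<Sum>n<q. ra n * rb n)"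
  \<comment> \<open>No closed form is required: \<open>2 * real q * X\<close> from the pairs cancels
    against the single sum.\<close>
  define X where "X = (\<Sum>n<q. ha n * hb n)"
  define H where "H = (1 / 2 - sq_sum) / 2"
  have ha: "(\<Sum>n<q. ha n) = H" and hb: "(\<Sum>n<q. hb n) = H"
    by (simp_all add: ha_def hb_def sum_subtractf sum_ra sum_rb sum_ra_sq sum_rb_sq H_def flip: sum_divide_distrib)
  have hab: "(\<Sum>n<q. ha n * rb n) = (D - 1 / 8) / 2" and hba: "(\<Sum>n<q. hb n * ra n) = (D - 1 / 8) / 2"
    using sum_ra_sq_rb sum_ra_rb_sq
    by (simp_all add: ha_def hb_def D_def right_diff_distrib left_diff_distrib sum_subtractf mult.commute power2_eq_square ac_simps flip: sum_divide_distrib)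
  have "(\<Sum>n<q. \<Sum>m<q. (3 / 8 + ha n + ha m + ra n * ra m + ka n m / 2) * (3 / 8 + hb n + hb m + rb n * rb m + kb n m / 2))
    = (\<Sum>n<q. \<Sum>m<q. 9 / 64 + 3 / 8 * (ha n + hb n) + 3 / 8 * (ha m + hb m) + 3 / 8 * (ra n * ra m) + 3 / 8 * (rb n * rb m)
        + 3 / 16 * ka n m + 3 / 16 * kb n m
        + ha n * hb n + ha m * hb m + ha n * hb m + ha m * hb n
        + (ha n * rb n) * rb m + (ha m * rb m) * rb n + (hb n * ra n) * ra m + (hb m * ra m) * ra n
        + 1 / 2 * (ha n * kb n m) + 1 / 2 * (ha m * kb n m) + 1 / 2 * (hb n * ka n m) + 1 / 2 * (hb m * ka n m)
        + (ra n * rb n) * (ra m * rb m) + 1 / 2 * (ra n * ra m * kb n m) + 1 / 2 * (rb n * rb m * ka n m)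
        + 1 / 4 * (ka n m * kb n m))"
    by (intro sum.cong) (simp_all add: field_simps)
  also have "\<dots> = 9 / 64 * (real q)\<^sup>2 + 3 / 2 * real q * H + 3 / 16 + 3 / 8 * real q * sq_sum + 2 * real q * X + 2 * H\<^sup>2
      + (D - 1 / 8) + 2 * H * sq_sum + D\<^sup>2 + (real q / 2 * sq_corr - real q * sq_sum / 8 + sq_sum\<^sup>2) + real q * sq_corr / 4"
    unfolding sum.distrib double_sum_cmult sum_f_ka sum_f_kb sum_ra_ra_kb sum_rb_rb_ka double_sum_outer double_sum_inner double_sum_times
      sum_ka sum_kb sum_ka_kb ha hb hab hba sum_ra sum_rb X_def[symmetric] D_def[symmetric]
    by (simp add: power2_eq_square algebra_simps)
  finally have pairs: "(\<Sum>n<q. \<Sum>m<q. (3 / 8 + ha n + ha m + ra n * ra m + ka n m / 2) * (3 / 8 + hb n + hb m + rb n * rb m + kb n m / 2)) = \<dots>" .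
  have "(\<Sum>n<q. (3 / 8 + ha n) * (3 / 8 + hb n)) = (\<Sum>n<q. 9 / 64 + 3 / 8 * (ha n + hb n) + ha n * hb n)"
    by (intro sum.cong) (simp_all add: field_simps)
  also have "\<dots> = 9 / 64 * real q + 3 / 4 * H + X"
    unfolding sum.distrib sum_distrib_left[symmetric] ha hb X_def by simp
  finally have points: "(\<Sum>n<q. (3 / 8 + ha n) * (3 / 8 + hb n)) = \<dots>" .
  show ?thesis
    unfolding pairs points H_def sum_ra_rb[folded D_def] by (simp add: power2_eq_square field_simps)
qed

end

section \<open>Integration over boxes\<close>

text \<open>One antiderivative serves all kernels, which are built from piecewise polynomials of
  degree at most three in the integration variable. Endpoints are null sets, so \<open>S\<close> may
  contain any of them.\<close>

lemma has_bochner_integral_cubic: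
  fixes a b c0 c1 c2 c3 :: real
  assumes "a \<le> b" and S: "{a<..<b} \<subseteq> S" "S \<subseteq> {a..b}"
  shows "has_bochner_integral lborel (\<lambda>x. indicator S x * (c0 + c1 * x + c2 * x\<^sup>2 + c3 * x ^ 3))
    (c0 * (b - a) + c1 * (b\<^sup>2 - a\<^sup>2) / 2 + c2 * (b ^ 3 - a ^ 3) / 3 + c3 * (b ^ 4 - a ^ 4) / 4)"
proof -
  let ?f = "\<lambda>x. c0 + c1 * x + c2 * x\<^sup>2 + c3 * x ^ 3"
  let ?F = "\<lambda>x. c0 * x + c1 * x\<^sup>2 / 2 + c2 * x ^ 3 / 3 + c3 * x ^ 4 / 4"
  have "has_bochner_integral lborel (\<lambda>x. ?f x * indicator {a..b} x) (?F b - ?F a)"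
  proof (rule has_bochner_integral_FTC_Icc_real[OF \<open>a \<le> b\<close>])
    show "DERIV ?F x :> ?f x" for x
      by (auto intro!: derivative_eq_intros simp: field_simps)
  qed (auto intro!: continuous_intros)
  also have "?F b - ?F a = c0 * (b - a) + c1 * (b\<^sup>2 - a\<^sup>2) / 2 + c2 * (b ^ 3 - a ^ 3) / 3 + c3 * (b ^ 4 - a ^ 4) / 4"
    by (simp add: field_simps)
  finally have main: "has_bochner_integral lborel (\<lambda>x. ?f x * indicator {a..b} x) \<dots>" .
  \<comment> \<open>An open interval plus at most two points is Borel.\<close>
  have "S = {a<..<b} \<union> (S \<inter> {a, b})" using S by force
  moreover have "S \<inter> {a, b} \<in> sets borel" by (intro borel_closed finite_imp_closed) auto
  ultimately have meas: "S \<in> sets borel" by (metis sets.Un borel_open open_greaterThanLessThan)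
  have "AE x in lborel. x \<noteq> a" "AE x in lborel. x \<noteq> b" by (rule AE_lborel_singleton)+
  then have "AE x in lborel. indicator S x * ?f x = ?f x * indicator {a..b} x"
  proof eventually_elim
    case (elim x)
    have "x \<in> S \<longleftrightarrow> x \<in> {a..b}" using S elim by force
    then show ?case by (simp split: split_indicator)
  qed
  then show ?thesis
    using meas by (subst has_bochner_integral_cong_AE[OF _ _ \<open>AE x in lborel. _ x = _ x\<close>]) (auto intro: main)
qed

lemma has_bochner_integral_eqI:
  assumes "has_bochner_integral M f a" "\<And>x. f x = g x" "a = b"
  shows "has_bochner_integral M g b"
proof -
  have "f = g" using assms(2) by (rule ext)
  with assms(1,3) show ?thesis by simp
qed

section \<open>Product integrals and iterated integrals\<close>

lemma has_bochner_integral_lborel_Times: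
  fixes f :: "'a::euclidean_space \<Rightarrow> real" and g :: "'b::euclidean_space \<Rightarrow> real"
  assumes "has_bochner_integral lborel f a" "has_bochner_integral lborel g b"
  shows "has_bochner_integral lborel (\<lambda>z. f (fst z) * g (snd z)) (a * b)"
proof -
  have f: "integrable lborel f" "integral\<^sup>L lborel f = a" and g: "integrable lborel g" "integral\<^sup>L lborel g = b"
    using assms by (auto simp: has_bochner_integral_iff)
  note [measurable] = borel_measurable_integrable[OF f(1)] borel_measurable_integrable[OF g(1)]
  have int: "integrable (lborel \<Otimes>\<^sub>M lborel) (\<lambda>z. f (fst z) * g (snd z))"
  proof (rule lborel_pair.Fubini_integrable)
    show "integrable lborel (\<lambda>x. LINT y|lborel. norm (f (fst (x, y)) * g (snd (x, y))))"
      using f g by (simp add: abs_mult)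
  qed (use g in \<open>auto\<close>)
  have "integral\<^sup>L (lborel \<Otimes>\<^sub>M lborel) (\<lambda>z. f (fst z) * g (snd z)) = a * b"
    unfolding lborel_pair.integral_fst'[OF int, symmetric] by (simp add: f g)
  with int show ?thesis by (simp add: has_bochner_integral_iff lborel_prod)
qed

text \<open>Follows the nesting of the extreme and periodic discrepancies, with the inner integral
  over the first component. As a relation demanding existence of both integrals it passes through
  linear combinations without joint measurability in both corners.\<close>

definition has_iterated_integral :: "('a::euclidean_space \<times> 'a \<Rightarrow> real) \<Rightarrow> real \<Rightarrow> bool" where
  "has_iterated_integral F c \<longleftrightarrow>
     (\<exists>G. (\<forall>y. has_bochner_integral lborel (\<lambda>x. F (x, y)) (G y)) \<and> has_bochner_integral lborel G c)"

lemma has_iterated_integralI: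
  assumes "\<And>y. has_bochner_integral lborel (\<lambda>x. F (x, y)) (G y)" "has_bochner_integral lborel G c"
  shows "has_iterated_integral F c"
  using assms unfolding has_iterated_integral_def by blast

lemma has_iterated_integral_add:
  assumes "has_iterated_integral f a" "has_iterated_integral g b"
  shows "has_iterated_integral (\<lambda>z. f z + g z) (a + b)"
  using assms unfolding has_iterated_integral_def
  by (elim exE conjE, intro exI[of _ "\<lambda>y. _ y + _ y"]) (auto intro: has_bochner_integral_add)

lemma has_iterated_integral_cmult:
  assumes "has_iterated_integral f a"
  shows "has_iterated_integral (\<lambda>z. c * f z) (c * a)"
  using assms unfolding has_iterated_integral_def
  by (elim exE conjE, intro exI[of _ "\<lambda>y. c * _ y"]) (auto intro: has_bochner_integral_mult_right)

text \<open>Here z is a pair of corners ((x1, x2), (y1, y2)). Regrouped by coordinates it gives the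
  endpoint pairs (x1, y1) and (x2, y2) of the two sides, and both integrals factor
  accordingly.\<close>

lemma has_iterated_integral_Times:
  fixes f g :: "real \<times> real \<Rightarrow> real"
  assumes "has_iterated_integral f a" "has_iterated_integral g b"
  shows "has_iterated_integral (\<lambda>z. f (fst (fst z), fst (snd z)) * g (snd (fst z), snd (snd z))) (a * b)"
proof -
  obtain F where F: "\<And>y. has_bochner_integral lborel (\<lambda>x. f (x, y)) (F y)" "has_bochner_integral lborel F a"
    using assms(1) unfolding has_iterated_integral_def by blast
  obtain G where G: "\<And>y. has_bochner_integral lborel (\<lambda>x. g (x, y)) (G y)" "has_bochner_integral lborel G b"
    using assms(2) unfolding has_iterated_integral_def by blast
  show ?thesis
  proof (rule has_iterated_integralI)
    fix y :: "real \<times> real"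
    show "has_bochner_integral lborel (\<lambda>x. f (fst (fst (x, y)), fst (snd (x, y))) * g (snd (fst (x, y)), snd (snd (x, y))))
       (F (fst y) * G (snd y))"
      using has_bochner_integral_lborel_Times[OF F(1)[of "fst y"] G(1)[of "snd y"]] by simp
    show "has_bochner_integral lborel (\<lambda>y. F (fst y) * G (snd y)) (a * b)"
      by (rule has_bochner_integral_lborel_Times[OF F(2) G(2)])
  qed
qed

lemma has_iterated_integralD:
  assumes "has_iterated_integral F c"
  shows "(LINT y|lborel. LINT x|lborel. F (x, y)) = c"
proof -
  obtain G where G: "\<And>y. has_bochner_integral lborel (\<lambda>x. F (x, y)) (G y)" "has_bochner_integral lborel G c"
    using assms unfolding has_iterated_integral_def by blast
  show ?thesis
    unfolding has_bochner_integral_integral_eq[OF G(1)] by (rule has_bochner_integral_integral_eq[OF G(2)])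
qed

text \<open>The relation \<open>K\<close> stands for integration over the parameters of a one-dimensional interval
  and \<open>J\<close> for integration over those of a two-dimensional box, so that the Warnock-type formulas
  of all three discrepancies are instances.\<close>

lemma warnock_formula:
  fixes K :: "('a \<Rightarrow> real) \<Rightarrow> real \<Rightarrow> bool" and J :: "('b \<Rightarrow> real) \<Rightarrow> real \<Rightarrow> bool"
    and \<pi>\<^sub>1 \<pi>\<^sub>2 :: "'b \<Rightarrow> 'a" and x y :: "nat \<Rightarrow> real"
  assumes add: "\<And>f g a b. J f a \<Longrightarrow> J g b \<Longrightarrow> J (\<lambda>z. f z + g z) (a + b)"
    and cmult: "\<And>f a c. J f a \<Longrightarrow> J (\<lambda>z. c * f z) (c * a)"
    and times: "\<And>f g a b. K f a \<Longrightarrow> K g b \<Longrightarrow> J (\<lambda>z. f (\<pi>\<^sub>1 z) * g (\<pi>\<^sub>2 z)) (a * b)"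
    and k: "\<And>s t. s \<in> {0..<1} \<Longrightarrow> t \<in> {0..<1} \<Longrightarrow> K (\<lambda>z. w z * u s z * u t z) (k s t)"
    and k1: "\<And>s. s \<in> {0..<1} \<Longrightarrow> K (\<lambda>z. w z * u s z * l z) (k1 s)"
    and k0: "K (\<lambda>z. w z * (l z)\<^sup>2) k0"
    and x: "\<And>i. x i \<in> {0..<1}" and y: "\<And>i. y i \<in> {0..<1}"
  shows "J (\<lambda>z. w (\<pi>\<^sub>1 z) * w (\<pi>\<^sub>2 z) * ((\<Sum>i<q. u (x i) (\<pi>\<^sub>1 z) * u (y i) (\<pi>\<^sub>2 z)) - real q * (l (\<pi>\<^sub>1 z) * l (\<pi>\<^sub>2 z)))\<^sup>2)
    ((\<Sum>i<q. \<Sum>j<q. k (x i) (x j) * k (y i) (y j)) - 2 * real q * (\<Sum>i<q. k1 (x i) * k1 (y i)) + (real q)\<^sup>2 * (k0 * k0))"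
proof -
  have zero: "J (\<lambda>z. 0) 0" using cmult[OF times[OF k0 k0], of 0] by simp
  have sum: "J (\<lambda>z. \<Sum>i<n. f i z) (\<Sum>i<n. a i)" if "\<And>i. J (f i) (a i)" for f a and n :: nat
    by (induction n) (auto simp: zero intro!: add that)
  \<comment> \<open>The weight \<open>w\<close> restricts the parameters, \<open>u s\<close> tells
    whether s lies in the interval and \<open>l\<close> is its length. The expanded square is
    integrated term by term.\<close>
  have "J (\<lambda>z. ((\<Sum>i<q. \<Sum>j<q. (w (\<pi>\<^sub>1 z) * u (x i) (\<pi>\<^sub>1 z) * u (x j) (\<pi>\<^sub>1 z)) * (w (\<pi>\<^sub>2 z) * u (y i) (\<pi>\<^sub>2 z) * u (y j) (\<pi>\<^sub>2 z)))
     + (- 2 * real q) * (\<Sum>i<q. (w (\<pi>\<^sub>1 z) * u (x i) (\<pi>\<^sub>1 z) * l (\<pi>\<^sub>1 z)) * (w (\<pi>\<^sub>2 z) * u (y i) (\<pi>\<^sub>2 z) * l (\<pi>\<^sub>2 z))))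
     + (real q)\<^sup>2 * ((w (\<pi>\<^sub>1 z) * (l (\<pi>\<^sub>1 z))\<^sup>2) * (w (\<pi>\<^sub>2 z) * (l (\<pi>\<^sub>2 z))\<^sup>2)))
    (((\<Sum>i<q. \<Sum>j<q. k (x i) (x j) * k (y i) (y j)) + (- 2 * real q) * (\<Sum>i<q. k1 (x i) * k1 (y i))) + (real q)\<^sup>2 * (k0 * k0))"
    by (intro add cmult sum times k k1 k0 x y)
  \<comment> \<open>The binomial expansion at a fixed z; each weight occurs to the first power in
    every term.\<close>
  moreover have "((\<Sum>i<q. \<Sum>j<q. (W1 * U1 i * U1 j) * (W2 * U2 i * U2 j))
     + (- 2 * real q) * (\<Sum>i<q. (W1 * U1 i * L1) * (W2 * U2 i * L2)))
     + (real q)\<^sup>2 * ((W1 * L1\<^sup>2) * (W2 * L2\<^sup>2)) = W1 * W2 * ((\<Sum>i<q. U1 i * U2 i) - real q * (L1 * L2))\<^sup>2" 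
    for W1 W2 L1 L2 :: real and U1 U2 :: "nat \<Rightarrow> real"
  proof -
    have "(\<Sum>i<q. \<Sum>j<q. (W1 * U1 i * U1 j) * (W2 * U2 i * U2 j))
        = W1 * W2 * ((\<Sum>i<q. U1 i * U2 i) * (\<Sum>i<q. U1 i * U2 i))"
      unfolding sum_product unfolding sum_distrib_left by (intro sum.cong) auto
    moreover have "(\<Sum>i<q. (W1 * U1 i * L1) * (W2 * U2 i * L2)) = W1 * W2 * L1 * L2 * (\<Sum>i<q. U1 i * U2 i)"
      unfolding sum_distrib_left by (intro sum.cong) auto
    ultimately show ?thesis by (simp add: power2_eq_square algebra_simps)
  qed
  ultimately show ?thesis by simp
qed

section \<open>One-dimensional kernels of the three discrepancies\<close>

lemma standard_kernel:
  assumes "s \<in> {0..<1::real}" "t \<in> {0..<1}"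
  shows "has_bochner_integral lborel (\<lambda>z. indicator {0..1} z * of_bool (s < z) * of_bool (t < z)) (1 - max s t)"
  by (rule has_bochner_integral_eqI[OF has_bochner_integral_cubic[of "max s t" 1 "{max s t<..1}" 1 0 0 0]])
    (use assms in \<open>auto simp: indicator_def\<close>)

lemma standard_kernel_1:
  assumes "s \<in> {0..<1::real}"
  shows "has_bochner_integral lborel (\<lambda>z. indicator {0..1} z * of_bool (s < z) * z) ((1 - s\<^sup>2) / 2)"
  by (rule has_bochner_integral_eqI[OF has_bochner_integral_cubic[of s 1 "{s<..1}" 0 1 0 0]])
    (use assms in \<open>auto simp: indicator_def\<close>)

lemma standard_kernel_0: "has_bochner_integral lborel (\<lambda>z::real. indicator {0..1} z * z\<^sup>2) (1 / 3)"
  by (rule has_bochner_integral_eqI[OF has_bochner_integral_cubic[of 0 1 "{0..1}" 0 0 1 0]]) auto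

text \<open>The domain of integration as a factor. Both \<open>unit_square\<close> and
  \<open>box_leq\<close> split by coordinates, so the domain of a pair of corners is a product of
  two such weights.\<close>

definition extr_weight :: "real \<times> real \<Rightarrow> real" where
  "extr_weight z = of_bool (0 \<le> fst z \<and> fst z \<le> snd z \<and> snd z \<le> 1)"

text \<open>Both points lie in [x, y) iff x <= min s t and max s t < y, so the admissible pairs of
  endpoints form a rectangle.\<close>

lemma extreme_kernel:
  assumes "s \<in> {0..<1::real}" "t \<in> {0..<1}"
  shows "has_iterated_integral (\<lambda>z. extr_weight z * of_bool (s \<in> {fst z..<snd z}) * of_bool (t \<in> {fst z..<snd z})) (min s t * (1 - max s t))"
proof (rule has_iterated_integralI)
  show "has_bochner_integral lborel (\<lambda>x. extr_weight (x, y) * of_bool (s \<in> {fst (x, y)..<snd (x, y)}) * of_bool (t \<in> {fst (x, y)..<snd (x, y)}))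
     (indicator {max s t<..1} y * min s t)" for y
    by (rule has_bochner_integral_eqI[OF has_bochner_integral_cubic[of 0 "min s t" "{0..min s t}" "indicator {max s t<..1} y" 0 0 0]])
      (use assms in \<open>auto simp: indicator_def extr_weight_def\<close>)
  show "has_bochner_integral lborel (\<lambda>y. indicator {max s t<..1} y * min s t) (min s t * (1 - max s t))"
    by (rule has_bochner_integral_eqI[OF has_bochner_integral_cubic[of "max s t" 1 "{max s t<..1}" "min s t" 0 0 0]])
      (use assms in \<open>auto\<close>)
qed

lemma extreme_kernel_1:
  assumes "s \<in> {0..<1::real}"
  shows "has_iterated_integral (\<lambda>z. extr_weight z * of_bool (s \<in> {fst z..<snd z}) * (snd z - fst z)) (s * (1 - s) / 2)"
proof (rule has_iterated_integralI)
  show "has_bochner_integral lborel (\<lambda>x. extr_weight (x, y) * of_bool (s \<in> {fst (x, y)..<snd (x, y)}) * (snd (x, y) - fst (x, y)))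
     (indicator {s<..1} y * (s * y - s\<^sup>2 / 2))" for y
    by (rule has_bochner_integral_eqI[OF has_bochner_integral_cubic[of 0 s "{0..s}" "indicator {s<..1} y * y" "- indicator {s<..1} y" 0 0]])
      (use assms in \<open>auto simp: indicator_def extr_weight_def algebra_simps\<close>)
  show "has_bochner_integral lborel (\<lambda>y. indicator {s<..1} y * (s * y - s\<^sup>2 / 2)) (s * (1 - s) / 2)"
    by (rule has_bochner_integral_eqI[OF has_bochner_integral_cubic[of s 1 "{s<..1}" "- s\<^sup>2 / 2" s 0 0]])
      (use assms in \<open>auto simp: algebra_simps power2_eq_square add_divide_distrib diff_divide_distrib\<close>)
qed

lemma extreme_kernel_0: "has_iterated_integral (\<lambda>z. extr_weight z * (snd z - fst z)\<^sup>2) (1 / 12)"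
proof (rule has_iterated_integralI)
  show "has_bochner_integral lborel (\<lambda>x. extr_weight (x, y) * (snd (x, y) - fst (x, y))\<^sup>2) (indicator {0..1} y * (y ^ 3 / 3))" for y
    \<comment> \<open>The bound \<open>max 0 y\<close> keeps the endpoints ordered for negative y,
      where the coefficients vanish anyway.\<close>
    by (rule has_bochner_integral_eqI[OF has_bochner_integral_cubic[of 0 "max 0 y" "{0..max 0 y}"
          "indicator {0..1} y * y\<^sup>2" "- 2 * indicator {0..1} y * y" "indicator {0..1} y" 0]])
      (auto simp: indicator_def extr_weight_def algebra_simps power2_eq_square power3_eq_cube max_def)
  show "has_bochner_integral lborel (\<lambda>y::real. indicator {0..1} y * (y ^ 3 / 3)) (1 / 12)"
    by (rule has_bochner_integral_eqI[OF has_bochner_integral_cubic[of 0 1 "{0..1}" 0 0 0 "1 / 3"]]) auto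
qed

definition per_weight :: "real \<times> real \<Rightarrow> real" where
  "per_weight z = of_bool (fst z \<in> {0..1} \<and> snd z \<in> {0..1})"

definition per_length :: "real \<times> real \<Rightarrow> real" where
  "per_length z = (if fst z \<le> snd z then snd z - fst z else 1 + snd z - fst z)"

lemma periodic_kernel_le:
  assumes "0 \<le> s" "s \<le> t" "t < (1::real)"
  shows "has_iterated_integral (\<lambda>z. per_weight z * of_bool (s \<in> per_interval (fst z) (snd z)) * of_bool (t \<in> per_interval (fst z) (snd z)))
    (1 / 2 - (t - s) + (t - s)\<^sup>2)"
proof (rule has_iterated_integralI)
  fix y
  \<comment> \<open>For an end y the admissible starts are (y, s] if y <= s, (y, t] if s < y <= t,
    and [0, s] together with (y, 1] if y > t. The interval wraps around exactly for x > y.\<close>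
  let ?I1 = "indicator {0..s} y :: real" and ?I2 = "indicator {s<..t} y :: real" and ?I3 = "indicator {t<..1} y :: real"
  \<comment> \<open>Zero coefficients are written out to keep each piece in the shape of
    \<open>has_bochner_integral_cubic\<close>.\<close>
  have "has_bochner_integral lborel (\<lambda>x. ?I1 * (indicator {y<..s} x * (1 + 0 * x + 0 * x\<^sup>2 + 0 * x ^ 3)) + ?I2 * (indicator {y<..t} x * (1 + 0 * x + 0 * x\<^sup>2 + 0 * x ^ 3))
     + (?I3 * (indicator {0..s} x * (1 + 0 * x + 0 * x\<^sup>2 + 0 * x ^ 3)) + ?I3 * (indicator {y<..1} x * (1 + 0 * x + 0 * x\<^sup>2 + 0 * x ^ 3))))
     (?I1 * (1 * (s - y) + 0 * (s\<^sup>2 - y\<^sup>2) / 2 + 0 * (s ^ 3 - y ^ 3) / 3 + 0 * (s ^ 4 - y ^ 4) / 4)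
      + ?I2 * (1 * (t - y) + 0 * (t\<^sup>2 - y\<^sup>2) / 2 + 0 * (t ^ 3 - y ^ 3) / 3 + 0 * (t ^ 4 - y ^ 4) / 4)
      + (?I3 * (1 * (s - 0) + 0 * (s\<^sup>2 - 0\<^sup>2) / 2 + 0 * (s ^ 3 - 0 ^ 3) / 3 + 0 * (s ^ 4 - 0 ^ 4) / 4)
        + ?I3 * (1 * (1 - y) + 0 * (1\<^sup>2 - y\<^sup>2) / 2 + 0 * (1 ^ 3 - y ^ 3) / 3 + 0 * (1 ^ 4 - y ^ 4) / 4)))"
    using assms by (intro has_bochner_integral_add has_bochner_integral_mult_right has_bochner_integral_cubic) (auto simp: indicator_eq_0_iff)
  then show "has_bochner_integral lborel (\<lambda>x. per_weight (x, y) * of_bool (s \<in> per_interval (fst (x, y)) (snd (x, y)))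
      * of_bool (t \<in> per_interval (fst (x, y)) (snd (x, y))))
     (?I1 * (s + (- 1) * y + 0 * y\<^sup>2 + 0 * y ^ 3) + ?I2 * (t + (- 1) * y + 0 * y\<^sup>2 + 0 * y ^ 3) + ?I3 * (s + 1 + (- 1) * y + 0 * y\<^sup>2 + 0 * y ^ 3))"
    by (rule has_bochner_integral_eqI)
      (use assms in \<open>auto simp: indicator_def per_weight_def per_interval_def\<close>)
next
  have "has_bochner_integral lborel (\<lambda>y. indicator {0..s} y * (s + (- 1) * y + 0 * y\<^sup>2 + 0 * y ^ 3) + indicator {s<..t} y * (t + (- 1) * y + 0 * y\<^sup>2 + 0 * y ^ 3)
     + indicator {t<..1} y * (s + 1 + (- 1) * y + 0 * y\<^sup>2 + 0 * y ^ 3))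
     ((s * (s - 0) + (- 1) * (s\<^sup>2 - 0\<^sup>2) / 2 + 0 * (s ^ 3 - 0 ^ 3) / 3 + 0 * (s ^ 4 - 0 ^ 4) / 4)
      + (t * (t - s) + (- 1) * (t\<^sup>2 - s\<^sup>2) / 2 + 0 * (t ^ 3 - s ^ 3) / 3 + 0 * (t ^ 4 - s ^ 4) / 4)
      + ((s + 1) * (1 - t) + (- 1) * (1\<^sup>2 - t\<^sup>2) / 2 + 0 * (1 ^ 3 - t ^ 3) / 3 + 0 * (1 ^ 4 - t ^ 4) / 4))"
    using assms by (intro has_bochner_integral_add has_bochner_integral_cubic) auto
  then show "has_bochner_integral lborel (\<lambda>y. indicator {0..s} y * (s + (- 1) * y + 0 * y\<^sup>2 + 0 * y ^ 3) + indicator {s<..t} y * (t + (- 1) * y + 0 * y\<^sup>2 + 0 * y ^ 3)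
     + indicator {t<..1} y * (s + 1 + (- 1) * y + 0 * y\<^sup>2 + 0 * y ^ 3)) (1 / 2 - (t - s) + (t - s)\<^sup>2)"
    by (rule has_bochner_integral_eqI) (auto simp: power2_eq_square field_simps)
qed

text \<open>The kernel is 1/3 plus the second Bernoulli polynomial at |s - t|; symmetry in s and t
  reduces it to ordered arguments.\<close>

lemma periodic_kernel:
  assumes "s \<in> {0..<1::real}" "t \<in> {0..<1}"
  shows "has_iterated_integral (\<lambda>z. per_weight z * of_bool (s \<in> per_interval (fst z) (snd z)) * of_bool (t \<in> per_interval (fst z) (snd z)))
    (1 / 2 - \<bar>s - t\<bar> + (s - t)\<^sup>2)"
proof (cases "s \<le> t")
  case True
  then show ?thesis using periodic_kernel_le[of s t] assms by (simp add: power2_commute)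
next
  case False
  then show ?thesis using periodic_kernel_le[of t s] assms by (simp add: ac_simps)
qed

lemma periodic_kernel_1:
  assumes "s \<in> {0..<1::real}"
  shows "has_iterated_integral (\<lambda>z. per_weight z * of_bool (s \<in> per_interval (fst z) (snd z)) * per_length z) (1 / 3)"
proof (rule has_iterated_integralI)
  fix y
  \<comment> \<open>An end y <= s forces y < x <= s with length 1 + y - x. For y > s either x <= s,
    with length y - x, or x > y, with length 1 + y - x.\<close>
  let ?I1 = "indicator {0..s} y :: real" and ?I3 = "indicator {s<..1} y :: real"
  have "has_bochner_integral lborel (\<lambda>x. ?I1 * (indicator {y<..s} x * ((1 + y) + (- 1) * x + 0 * x\<^sup>2 + 0 * x ^ 3))
     + (?I3 * (indicator {0..s} x * (y + (- 1) * x + 0 * x\<^sup>2 + 0 * x ^ 3)) + ?I3 * (indicator {y<..1} x * ((1 + y) + (- 1) * x + 0 * x\<^sup>2 + 0 * x ^ 3))))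
     (?I1 * ((1 + y) * (s - y) + (- 1) * (s\<^sup>2 - y\<^sup>2) / 2 + 0 * (s ^ 3 - y ^ 3) / 3 + 0 * (s ^ 4 - y ^ 4) / 4)
      + (?I3 * (y * (s - 0) + (- 1) * (s\<^sup>2 - 0\<^sup>2) / 2 + 0 * (s ^ 3 - 0 ^ 3) / 3 + 0 * (s ^ 4 - 0 ^ 4) / 4)
        + ?I3 * ((1 + y) * (1 - y) + (- 1) * (1\<^sup>2 - y\<^sup>2) / 2 + 0 * (1 ^ 3 - y ^ 3) / 3 + 0 * (1 ^ 4 - y ^ 4) / 4)))"
    using assms by (intro has_bochner_integral_add has_bochner_integral_mult_right has_bochner_integral_cubic) (auto simp: indicator_eq_0_iff)
  then show "has_bochner_integral lborel (\<lambda>x. per_weight (x, y) * of_bool (s \<in> per_interval (fst (x, y)) (snd (x, y))) * per_length (x, y))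
     (?I1 * ((s - s\<^sup>2 / 2) + (s - 1) * y + (- 1 / 2) * y\<^sup>2 + 0 * y ^ 3) + ?I3 * ((1 / 2 - s\<^sup>2 / 2) + s * y + (- 1 / 2) * y\<^sup>2 + 0 * y ^ 3))"
    by (rule has_bochner_integral_eqI)
      (use assms in \<open>auto simp: indicator_def per_weight_def per_length_def per_interval_def field_simps power2_eq_square\<close>)
next
  have "has_bochner_integral lborel (\<lambda>y. indicator {0..s} y * ((s - s\<^sup>2 / 2) + (s - 1) * y + (- 1 / 2) * y\<^sup>2 + 0 * y ^ 3)
     + indicator {s<..1} y * ((1 / 2 - s\<^sup>2 / 2) + s * y + (- 1 / 2) * y\<^sup>2 + 0 * y ^ 3))
     (((s - s\<^sup>2 / 2) * (s - 0) + (s - 1) * (s\<^sup>2 - 0\<^sup>2) / 2 + (- 1 / 2) * (s ^ 3 - 0 ^ 3) / 3 + 0 * (s ^ 4 - 0 ^ 4) / 4)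
      + ((1 / 2 - s\<^sup>2 / 2) * (1 - s) + s * (1\<^sup>2 - s\<^sup>2) / 2 + (- 1 / 2) * (1 ^ 3 - s ^ 3) / 3 + 0 * (1 ^ 4 - s ^ 4) / 4))"
    using assms by (intro has_bochner_integral_add has_bochner_integral_cubic) auto
  then show "has_bochner_integral lborel (\<lambda>y. indicator {0..s} y * ((s - s\<^sup>2 / 2) + (s - 1) * y + (- 1 / 2) * y\<^sup>2 + 0 * y ^ 3)
     + indicator {s<..1} y * ((1 / 2 - s\<^sup>2 / 2) + s * y + (- 1 / 2) * y\<^sup>2 + 0 * y ^ 3)) (1 / 3)"
    by (rule has_bochner_integral_eqI) (auto simp: power2_eq_square power3_eq_cube field_simps)
qed

text \<open>For each fixed end in [0, 1] the length is uniformly distributed on the unit interval,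
  so the inner integral is already 1/3.\<close>

lemma periodic_kernel_0: "has_iterated_integral (\<lambda>z. per_weight z * (per_length z)\<^sup>2) (1 / 3)"
proof (rule has_iterated_integralI)
  fix y :: real
  let ?I = "indicator {0..1} y :: real"
  have "has_bochner_integral lborel (\<lambda>x. ?I * (indicator {0..y} x * (y\<^sup>2 + (- 2 * y) * x + 1 * x\<^sup>2 + 0 * x ^ 3))
     + ?I * (indicator {y<..1} x * ((1 + y)\<^sup>2 + (- 2 * (1 + y)) * x + 1 * x\<^sup>2 + 0 * x ^ 3)))
     (?I * (y\<^sup>2 * (y - 0) + (- 2 * y) * (y\<^sup>2 - 0\<^sup>2) / 2 + 1 * (y ^ 3 - 0 ^ 3) / 3 + 0 * (y ^ 4 - 0 ^ 4) / 4)
      + ?I * ((1 + y)\<^sup>2 * (1 - y) + (- 2 * (1 + y)) * (1\<^sup>2 - y\<^sup>2) / 2 + 1 * (1 ^ 3 - y ^ 3) / 3 + 0 * (1 ^ 4 - y ^ 4) / 4))"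
    by (intro has_bochner_integral_add has_bochner_integral_mult_right has_bochner_integral_cubic) (auto simp: indicator_eq_0_iff)
  then show "has_bochner_integral lborel (\<lambda>x. per_weight (x, y) * (per_length (x, y))\<^sup>2)
     (?I * (1 / 3 + 0 * y + 0 * y\<^sup>2 + 0 * y ^ 3))"
    by (rule has_bochner_integral_eqI)
      (auto simp: indicator_def per_weight_def per_length_def field_simps power2_eq_square power3_eq_cube)
next
  show "has_bochner_integral lborel (\<lambda>y::real. indicator {0..1} y * (1 / 3 + 0 * y + 0 * y\<^sup>2 + 0 * y ^ 3)) (1 / 3)"
    by (rule has_bochner_integral_eqI[OF has_bochner_integral_cubic[of 0 1 "{0..1}" "1 / 3" 0 0 0]]) auto
qed

section \<open>The discrepancies of the lattice\<close>

text \<open>The fractional part of s - t is |s - t| or 1 - |s - t|, and the squared sawtooth is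
  symmetric about 1/2.\<close>

lemma rho_diff_sq_unit:
  assumes "s \<in> {0..<1}" "t \<in> {0..<1}"
  shows "(rho (s - t))\<^sup>2 = (1 / 2 - \<bar>s - t\<bar>)\<^sup>2"
proof (cases "t \<le> s")
  case True
  then have "frac (s - t) = s - t" using assms by (simp add: frac_eq)
  then show ?thesis using True by (simp add: rho_def)
next
  case False
  then have frac: "frac (s - t) = s - t + 1"
    using assms by (intro frac_unique_iff[THEN iffD2]) auto
  show ?thesis unfolding rho_def frac using False by (simp add: power2_eq_square algebra_simps)
qed

lemma rho_unit: "s \<in> {0..<1} \<Longrightarrow> rho s = 1 / 2 - s"
  by (simp add: rho_def frac_eq)

text \<open>All three follow from |s - t| = 1/4 - rho(s - t)^2 + (rho s - rho t)^2, since max and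
  min are half of s + t plus or minus |s - t| and their product is s t. Periodicity then lets
  residues replace the coordinates.\<close>

lemma kernels_rho:
  assumes "s \<in> {0..<1}" "t \<in> {0..<1}"
  shows "1 / 2 - \<bar>s - t\<bar> + (s - t)\<^sup>2 = 1 / 4 + (rho (s - t))\<^sup>2"
    and "1 - max s t = 3 / 8 + (rho s - (rho s)\<^sup>2) / 2 + (rho t - (rho t)\<^sup>2) / 2 + rho s * rho t + (rho (s - t))\<^sup>2 / 2"
    and "min s t * (1 - max s t) = 1 / 8 + (rho (s - t))\<^sup>2 / 2 - (rho s)\<^sup>2 / 2 - (rho t)\<^sup>2 / 2"
  unfolding rho_diff_sq_unit[OF assms] rho_unit[OF assms(1)] rho_unit[OF assms(2)]
  by (auto simp: power2_eq_square field_simps max_def min_def abs_if)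

lemma kernels_1_rho:
  assumes "s \<in> {0..<1}"
  shows "(1 - s\<^sup>2) / 2 = 3 / 8 + (rho s - (rho s)\<^sup>2) / 2"
    and "s * (1 - s) / 2 = 1 / 8 - (rho s)\<^sup>2 / 2"
  unfolding rho_unit[OF assms] by (simp_all add: power2_eq_square field_simps)

lemma rho_frac_diff: "rho (frac x - frac y) = rho (x - y)"
proof -
  have "frac x - frac y = x - y + of_int (\<lfloor>y\<rfloor> - \<lfloor>x\<rfloor>)" by (simp add: frac_def)
  then show ?thesis by (simp only: rho_add_int)
qed

lemma measure_lborel_Times:
  fixes A :: "'a::euclidean_space set" and B :: "'b::euclidean_space set"
  assumes "A \<in> sets borel" "B \<in> sets borel"
  shows "measure lborel (A \<times> B) = measure lborel A * measure lborel B"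
  using lborel.emeasure_pair_measure_Times[of A lborel B] assms
  by (simp add: lborel_prod measure_def enn2real_mult)

lemma measure_per_interval:
  assumes "x \<in> {0..1}" "y \<in> {0..1}"
  shows "measure lborel (per_interval x y) = per_length (x, y)"
proof (cases "x \<le> y")
  case False
  then have "measure lborel ({0..<y} \<union> {x..<1}) = measure lborel {0..<y} + measure lborel {x..<1}"
    using assms by (intro measure_Union) auto
  with False show ?thesis using assms by (simp add: per_interval_def per_length_def)
qed (simp add: per_interval_def per_length_def)

lemma per_interval_borel [simp]: "per_interval x y \<in> sets borel"
  by (simp add: per_interval_def)

section \<open>Local discrepancy and the three integrals for the lattice\<close>

context lattice_sums begin

text \<open>The fractional part keeps \<open>pa\<close> in the unit interval for every index, as
  \<open>warnock_formula\<close> demands.\<close>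

definition "pa i = frac (real i / real q)"
definition "pb i = frac (real i * of_int p / real q)"

lemma pa_unit: "pa i \<in> {0..<1}" and pb_unit: "pb i \<in> {0..<1}"
  by (simp_all add: pa_def pb_def frac_lt_1)

lemma pa_eq: "i < q \<Longrightarrow> pa i = real i / real q"
  by (simp add: pa_def frac_eq)

lemma rational_lattice_eq: "rational_lattice p q = (\<lambda>i. (pa i, pb i)) ` {..<q}"
  unfolding rational_lattice_def by (intro image_cong) (auto simp: pa_eq pb_def)

lemma inj_lattice: "inj_on (\<lambda>i. (pa i, pb i)) {..<q}"
  using q by (auto simp: inj_on_def pa_eq)

lemma local_disc_lattice:
  assumes "A \<in> sets borel" "B \<in> sets borel"
  shows "local_disc (A \<times> B) (rational_lattice p q)
    = (\<Sum>i<q. of_bool (pa i \<in> A) * of_bool (pb i \<in> B)) - real q * (measure lborel A * measure lborel B)"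
proof -
  have "{x \<in> rational_lattice p q. x \<in> A \<times> B} = (\<lambda>i. (pa i, pb i)) ` {i\<in>{..<q}. pa i \<in> A \<and> pb i \<in> B}"
    unfolding rational_lattice_eq by auto
  then have "count_in (A \<times> B) (rational_lattice p q) = card {i\<in>{..<q}. pa i \<in> A \<and> pb i \<in> B}"
    unfolding count_in_def by (auto intro!: card_image inj_on_subset[OF inj_lattice])
  moreover have "real (card {i\<in>{..<q}. pa i \<in> A \<and> pb i \<in> B}) = (\<Sum>i<q. of_bool (pa i \<in> A) * of_bool (pb i \<in> B))"
    by (simp add: of_bool_conj[symmetric] Int_def)
  moreover have "card (rational_lattice p q) = q"
    unfolding rational_lattice_eq by (simp add: card_image inj_lattice)
  ultimately show ?thesis
    by (simp add: local_disc_def measure_lborel_Times assms)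
qed

lemma rho_pa: "rho (pa i) = ra i" and rho_pb: "rho (pb i) = rb i"
  and rho_pa_diff: "(rho (pa i - pa j))\<^sup>2 = ka i j" and rho_pb_diff: "(rho (pb i - pb j))\<^sup>2 = kb i j"
  by (simp_all add: pa_def pb_def ra_def rb_def ka_def kb_def rho_frac_diff left_diff_distrib diff_divide_distrib)

lemma L2_disc_rational_lattice:
  "(L2_disc (rational_lattice p q))\<^sup>2 = 3 / 4 * real q * sq_corr + (inhom_dedekind_sum p q + 3 / 4)\<^sup>2
    + sq_sum\<^sup>2 / 2 + real q * sq_sum / 4 - 17 / 576 * (real q)\<^sup>2 - 1 / 16"
proof -
  have "has_bochner_integral lborel (\<lambda>z. indicator {0..1} (fst z) * indicator {0..1} (snd z)
      * ((\<Sum>i<q. of_bool (pa i < fst z) * of_bool (pb i < snd z)) - real q * (fst z * snd z))\<^sup>2)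
    ((\<Sum>i<q. \<Sum>j<q. (1 - max (pa i) (pa j)) * (1 - max (pb i) (pb j)))
      - 2 * real q * (\<Sum>i<q. ((1 - (pa i)\<^sup>2) / 2) * ((1 - (pb i)\<^sup>2) / 2)) + (real q)\<^sup>2 * (1 / 3 * (1 / 3)))"
    by (rule warnock_formula[where \<pi>\<^sub>1 = fst and \<pi>\<^sub>2 = snd and J = "has_bochner_integral lborel" and K = "has_bochner_integral lborel"])
      (auto intro: standard_kernel standard_kernel_1 standard_kernel_0 has_bochner_integral_lborel_Times pa_unit pb_unit
        simp del: atLeastLessThan_iff)
  also have "(\<Sum>i<q. \<Sum>j<q. (1 - max (pa i) (pa j)) * (1 - max (pb i) (pb j)))
      - 2 * real q * (\<Sum>i<q. ((1 - (pa i)\<^sup>2) / 2) * ((1 - (pb i)\<^sup>2) / 2)) + (real q)\<^sup>2 * (1 / 3 * (1 / 3))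
    = 3 / 4 * real q * sq_corr + (inhom_dedekind_sum p q + 3 / 4)\<^sup>2 + sq_sum\<^sup>2 / 2 + real q * sq_sum / 4 - 17 / 576 * (real q)\<^sup>2 - 1 / 16"
    unfolding standard_sum[symmetric] kernels_rho(2)[OF pa_unit pa_unit] kernels_rho(2)[OF pb_unit pb_unit]
      kernels_1_rho(1)[OF pa_unit] kernels_1_rho(1)[OF pb_unit] rho_pa rho_pb rho_pa_diff rho_pb_diff ha_def hb_def ..
  also have "(\<lambda>z. indicator {0..1} (fst z) * indicator {0..1} (snd z)
      * ((\<Sum>i<q. of_bool (pa i < fst z) * of_bool (pb i < snd z)) - real q * (fst z * snd z))\<^sup>2)
    = (\<lambda>z. indicator unit_square z *\<^sub>R \<bar>local_disc (ho_box (0, 0) z) (rational_lattice p q)\<bar>\<^sup>2)"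
  proof
    fix z :: "real \<times> real"
    \<comment> \<open>With the lower corner at the origin, membership in the box reduces to the
      upper bounds.\<close>
    have "0 \<le> pa i" "0 \<le> pb i" for i using pa_unit[of i] pb_unit[of i] by auto
    then show "indicator {0..1} (fst z) * indicator {0..1} (snd z)
      * ((\<Sum>i<q. of_bool (pa i < fst z) * of_bool (pb i < snd z)) - real q * (fst z * snd z))\<^sup>2
      = indicator unit_square z *\<^sub>R \<bar>local_disc (ho_box (0, 0) z) (rational_lattice p q)\<bar>\<^sup>2"
      by (auto simp: unit_square_def ho_box_def local_disc_lattice indicator_def mem_Times_iff)
  qed
  finally have *: "(LINT t:unit_square|lborel. \<bar>local_disc (ho_box (0, 0) t) (rational_lattice p q)\<bar>\<^sup>2)
    = 3 / 4 * real q * sq_corr + (inhom_dedekind_sum p q + 3 / 4)\<^sup>2 + sq_sum\<^sup>2 / 2 + real q * sq_sum / 4 - 17 / 576 * (real q)\<^sup>2 - 1 / 16"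
    unfolding set_lebesgue_integral_def by (rule has_bochner_integral_integral_eq)
  \<comment> \<open>Nonnegativity lets squaring undo the square root.\<close>
  have "(LINT t:unit_square|lborel. \<bar>local_disc (ho_box (0, 0) t) (rational_lattice p q)\<bar>\<^sup>2) \<ge> 0"
    unfolding set_lebesgue_integral_def by (intro Bochner_Integration.integral_nonneg) simp
  then show ?thesis unfolding L2_disc_def * by simp
qed

lemma L2_disc_extr_rational_lattice:
  "(L2_disc_extr (rational_lattice p q))\<^sup>2 = real q * sq_corr / 4 - sq_sum\<^sup>2 / 2 + real q * sq_sum / 8 - 5 / 576 * (real q)\<^sup>2"
proof -
  \<comment> \<open>The unreduced projections of pairs match the instances of
    \<open>\<pi>\<^sub>1\<close> and \<open>\<pi>\<^sub>2\<close> in \<open>warnock_formula\<close>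
    literally.\<close>
  let ?F = "\<lambda>z :: (real \<times> real) \<times> real \<times> real. extr_weight (fst (fst z), fst (snd z)) * extr_weight (snd (fst z), snd (snd z))
      * ((\<Sum>i<q. of_bool (pa i \<in> {fst (fst (fst z), fst (snd z))..<snd (fst (fst z), fst (snd z))})
            * of_bool (pb i \<in> {fst (snd (fst z), snd (snd z))..<snd (snd (fst z), snd (snd z))}))
         - real q * ((snd (fst (fst z), fst (snd z)) - fst (fst (fst z), fst (snd z)))
             * (snd (snd (fst z), snd (snd z)) - fst (snd (fst z), snd (snd z)))))\<^sup>2"
  have "has_iterated_integral ?F
    ((\<Sum>i<q. \<Sum>j<q. (min (pa i) (pa j) * (1 - max (pa i) (pa j))) * (min (pb i) (pb j) * (1 - max (pb i) (pb j))))
      - 2 * real q * (\<Sum>i<q. (pa i * (1 - pa i) / 2) * (pb i * (1 - pb i) / 2)) + (real q)\<^sup>2 * (1 / 12 * (1 / 12)))"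
    by (rule warnock_formula[where \<pi>\<^sub>1 = "\<lambda>z. (fst (fst z), fst (snd z))" and \<pi>\<^sub>2 = "\<lambda>z. (snd (fst z), snd (snd z))"
          and J = has_iterated_integral and K = has_iterated_integral, OF has_iterated_integral_add has_iterated_integral_cmult
            has_iterated_integral_Times extreme_kernel extreme_kernel_1 extreme_kernel_0 pa_unit pb_unit])
  also have "((\<Sum>i<q. \<Sum>j<q. (min (pa i) (pa j) * (1 - max (pa i) (pa j))) * (min (pb i) (pb j) * (1 - max (pb i) (pb j))))
      - 2 * real q * (\<Sum>i<q. (pa i * (1 - pa i) / 2) * (pb i * (1 - pb i) / 2)) + (real q)\<^sup>2 * (1 / 12 * (1 / 12)))
    = real q * sq_corr / 4 - sq_sum\<^sup>2 / 2 + real q * sq_sum / 8 - 5 / 576 * (real q)\<^sup>2"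
    unfolding extreme_sum[symmetric] kernels_rho(3)[OF pa_unit pa_unit] kernels_rho(3)[OF pb_unit pb_unit]
      kernels_1_rho(2)[OF pa_unit] kernels_1_rho(2)[OF pb_unit] rho_pa rho_pb rho_pa_diff rho_pb_diff ..
  finally have "(LINT y|lborel. LINT x|lborel. ?F (x, y)) = real q * sq_corr / 4 - sq_sum\<^sup>2 / 2 + real q * sq_sum / 8 - 5 / 576 * (real q)\<^sup>2"
    by (rule has_iterated_integralD)
  moreover have "?F (x, y) = indicator unit_square y *\<^sub>R (indicator {x \<in> unit_square. box_leq x y} x *\<^sub>R \<bar>local_disc (ho_box x y) (rational_lattice p q)\<bar>\<^sup>2)" for x y
  proof (cases "y \<in> unit_square \<and> x \<in> unit_square \<and> box_leq x y")
    case True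
    then show ?thesis
      by (simp add: ho_box_def local_disc_lattice extr_weight_def unit_square_def box_leq_def mem_Times_iff)
  next
    case False
    then show ?thesis
      by (auto simp: extr_weight_def unit_square_def box_leq_def mem_Times_iff)
  qed
  ultimately have *: "(LINT y:unit_square|lborel. (LINT x:{x \<in> unit_square. box_leq x y}|lborel. \<bar>local_disc (ho_box x y) (rational_lattice p q)\<bar>\<^sup>2))
    = real q * sq_corr / 4 - sq_sum\<^sup>2 / 2 + real q * sq_sum / 8 - 5 / 576 * (real q)\<^sup>2"
    unfolding set_lebesgue_integral_def by simp
  have "(LINT y:unit_square|lborel. (LINT x:{x \<in> unit_square. box_leq x y}|lborel. \<bar>local_disc (ho_box x y) (rational_lattice p q)\<bar>\<^sup>2)) \<ge> 0"
    unfolding set_lebesgue_integral_def by (intro Bochner_Integration.integral_nonneg scaleR_nonneg_nonneg) simp_all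
  then show ?thesis unfolding L2_disc_extr_def * by simp
qed

lemma L2_disc_per_rational_lattice:
  "(L2_disc_per (rational_lattice p q))\<^sup>2 = real q * sq_corr + real q * sq_sum / 2 - 7 / 144 * (real q)\<^sup>2"
proof -
  let ?F = "\<lambda>z :: (real \<times> real) \<times> real \<times> real. per_weight (fst (fst z), fst (snd z)) * per_weight (snd (fst z), snd (snd z))
      * ((\<Sum>i<q. of_bool (pa i \<in> per_interval (fst (fst (fst z), fst (snd z))) (snd (fst (fst z), fst (snd z))))
            * of_bool (pb i \<in> per_interval (fst (snd (fst z), snd (snd z))) (snd (snd (fst z), snd (snd z)))))
         - real q * (per_length (fst (fst z), fst (snd z)) * per_length (snd (fst z), snd (snd z))))\<^sup>2"
  have "has_iterated_integral ?F
    ((\<Sum>i<q. \<Sum>j<q. (1 / 2 - \<bar>pa i - pa j\<bar> + (pa i - pa j)\<^sup>2) * (1 / 2 - \<bar>pb i - pb j\<bar> + (pb i - pb j)\<^sup>2))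
      - 2 * real q * (\<Sum>i<q. 1 / 3 * (1 / 3)) + (real q)\<^sup>2 * (1 / 3 * (1 / 3)))"
    by (rule warnock_formula[where \<pi>\<^sub>1 = "\<lambda>z. (fst (fst z), fst (snd z))" and \<pi>\<^sub>2 = "\<lambda>z. (snd (fst z), snd (snd z))"
          and J = has_iterated_integral and K = has_iterated_integral, OF has_iterated_integral_add has_iterated_integral_cmult
            has_iterated_integral_Times periodic_kernel periodic_kernel_1 periodic_kernel_0 pa_unit pb_unit])
  also have "((\<Sum>i<q. \<Sum>j<q. (1 / 2 - \<bar>pa i - pa j\<bar> + (pa i - pa j)\<^sup>2) * (1 / 2 - \<bar>pb i - pb j\<bar> + (pb i - pb j)\<^sup>2))
      - 2 * real q * (\<Sum>i<q. 1 / 3 * (1 / 3)) + (real q)\<^sup>2 * (1 / 3 * (1 / 3)))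
    = real q * sq_corr + real q * sq_sum / 2 - 7 / 144 * (real q)\<^sup>2"
    unfolding periodic_sum[symmetric] kernels_rho(1)[OF pa_unit pa_unit] kernels_rho(1)[OF pb_unit pb_unit]
      rho_pa_diff rho_pb_diff ..
  finally have "(LINT y|lborel. LINT x|lborel. ?F (x, y)) = real q * sq_corr + real q * sq_sum / 2 - 7 / 144 * (real q)\<^sup>2"
    by (rule has_iterated_integralD)
  moreover have "?F (x, y) = indicator unit_square y *\<^sub>R (indicator unit_square x *\<^sub>R \<bar>local_disc (per_box x y) (rational_lattice p q)\<bar>\<^sup>2)" for x y
  \<comment> \<open>Outside the unit square the weights vanish; inside it \<open>per_length\<close>
    is the measure of the periodic interval.\<close>
  proof (cases "y \<in> unit_square \<and> x \<in> unit_square")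
    case True
    then show ?thesis
      by (simp add: per_box_def local_disc_lattice measure_per_interval per_weight_def unit_square_def mem_Times_iff)
  next
    case False
    then show ?thesis
      by (auto simp: per_weight_def unit_square_def mem_Times_iff)
  qed
  ultimately have *: "(LINT y:unit_square|lborel. (LINT x:unit_square|lborel. \<bar>local_disc (per_box x y) (rational_lattice p q)\<bar>\<^sup>2))
    = real q * sq_corr + real q * sq_sum / 2 - 7 / 144 * (real q)\<^sup>2"
    unfolding set_lebesgue_integral_def by simp
  have "(LINT y:unit_square|lborel. (LINT x:unit_square|lborel. \<bar>local_disc (per_box x y) (rational_lattice p q)\<bar>\<^sup>2)) \<ge> 0"
    unfolding set_lebesgue_integral_def by (intro Bochner_Integration.integral_nonneg scaleR_nonneg_nonneg) simp_all
  then show ?thesis unfolding L2_disc_per_def * by simp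
qed

lemma sq_corr_eq: "sq_corr = sq_sum\<^sup>2 / real q + 1 / (4 * real q ^ 3) * (\<Sum>r=1..<q. 1 /
            ((sin (pi * real r / real q))\<^sup>2 * (sin (pi * real r * of_int p / real q))\<^sup>2))"
  using sum_rho_sq_rho_sq[OF q cop] by (simp add: sq_corr_def ra_def rb_def sq_sum_def)

end

theorem theorem10:
  fixes \<alpha> :: real and a :: "nat \<Rightarrow> int" and n :: nat and p :: int and q :: nat
  assumes "\<alpha> \<notin> \<rat>"
    and "has_cfrac_expansion \<alpha> a"
    and "q \<ge> 1" and "coprime p (int q)"
    and "real_of_int p / real q = fin_cfrac a n"
  shows
    "(L2_disc (rational_lattice p q))\<^sup>2 =
       1 / (16 * (real q)\<^sup>2) *
         (\<Sum>r=1..<q. (1 + 2 * (cos (pi * real r * real_of_int p / real q))\<^sup>2) /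
            ((sin (pi * real r / real q))\<^sup>2 * (sin (pi * real r * real_of_int p / real q))\<^sup>2))
       + (inhom_dedekind_sum p q + 3 / 4)\<^sup>2 + 1 / 18 - 1 / (144 * (real q)\<^sup>2)
     \<and> (L2_disc_extr (rational_lattice p q))\<^sup>2 =
       1 / (16 * (real q)\<^sup>2) *
         (\<Sum>r=1..<q. 1 /
            ((sin (pi * real r / real q))\<^sup>2 * (sin (pi * real r * real_of_int p / real q))\<^sup>2))
       + 1 / 72 - 1 / (144 * (real q)\<^sup>2)
     \<and> (L2_disc_per (rational_lattice p q))\<^sup>2 =
       1 / (4 * (real q)\<^sup>2) *
         (\<Sum>r=1..<q. 1 /
            ((sin (pi * real r / real q))\<^sup>2 * (sin (pi * real r * real_of_int p / real q))\<^sup>2))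
       + 1 / 9 + 1 / (36 * (real q)\<^sup>2)"
proof -
  interpret lattice_sums q p by unfold_locales fact+
  define S where "S = (\<Sum>r=1..<q. 1 /
            ((sin (pi * real r / real q))\<^sup>2 * (sin (pi * real r * real_of_int p / real q))\<^sup>2))"
  \<comment> \<open>In terms of e, the discrepancy formulas become linear in q^2, e and e S, apart
    from the squared Dedekind term.\<close>
  define e where "e = 1 / (real q)\<^sup>2"
  have nz: "real q \<noteq> 0" using q by simp
  have s_sq: "sq_sum\<^sup>2 = (real q)\<^sup>2 / 144 + 1 / 36 + e / 36"
    and q_s: "real q * sq_sum = (real q)\<^sup>2 / 12 + 1 / 6"
    and cos_part: "1 / (16 * (real q)\<^sup>2) * (3 * S - 2 * ((real q)\<^sup>2 - 1) / 3) = 3 / 16 * (e * S) - 1 / 24 + e / 24"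
    using nz by (simp_all add: sq_sum_def e_def field_simps power2_eq_square)
  have q_sq_corr: "real q * sq_corr = sq_sum\<^sup>2 + e * S / 4"
    unfolding sq_corr_eq S_def[symmetric] using nz by (simp add: e_def field_simps power2_eq_square power3_eq_cube)
  have e: "1 / (16 * (real q)\<^sup>2) * S = e * S / 16" "1 / (4 * (real q)\<^sup>2) * S = e * S / 4"
    "1 / (144 * (real q)\<^sup>2) = e / 144" "1 / (36 * (real q)\<^sup>2) = e / 36"
    by (simp_all add: e_def)
  show ?thesis
    \<comment> \<open>Reassociating at 3/4 exposes the product \<open>real q * sq_corr\<close> for
      rewriting.\<close>
    unfolding L2_disc_rational_lattice L2_disc_extr_rational_lattice L2_disc_per_rational_lattice
      sum_cos_sq_csc_sq[OF q cop] S_def[symmetric] mult.assoc[of "3 / 4"] q_sq_corr q_s s_sq cos_part e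
    by (simp add: field_simps)
qed

end
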